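(* Let $f:\mathbb T^2\to\mathbb C$ be continuous. Then the following convergences hold uniformly in $t\in\mathbb Z_q^\times$ as $q\to\infty$: (i) for any sequence of $q$: $\frac{1}{\phi(q)}\sum_{p\in\mathbb Z_q^\times}f\big(\frac pq,\frac{t\overline p}{q}\big)\to\int_{\mathbb T^2}f(x)\,dx$; (ii) for $q\equiv0\bmod4$ not a square and every $\sigma\in\{\pm1,\pm i\}$: $\frac{1}{\phi(q)}\sum_{p\in\mathbb Z_q^\times,\ \epsilon_p(\frac qp)=\sigma}f\big(\frac pq,\frac{t\overline p}{q}\big)\to\frac14\int_{\mathbb T^2}f(x)\,dx$; (iii) for $q\equiv0\bmod4$ and every $\sigma\in\{\pm1\}$: $\frac{1}{\phi(q)}\sum_{p\in\mathbb Z_q^\times,\ p\equiv\sigma\bmod4}f\big(\frac pq,\frac{t\overline p}{q}\big)\to\frac12\int_{\mathbb T^2}f(x)\,dx$; (iv) for $q\equiv1\bmod2$ not a square and every $\sigma\in\{\pm1\}$: $\frac{1}{\phi(q)}\sum_{p\in\mathbb Z_q^\times,\ (\frac pq)=\sigma}f\big(\frac pq,\frac{t\overline p}{q}\big)\to\frac12\int_{\mathbb T^2}f(x)\,dx$.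
   Context: $\mathbb T=\mathbb R/\mathbb Z$; $\mathbb Z_q^\times=\{p\in\{1,\dots,q\}:\gcd(p,q)=1\}$ and $\phi(q)=|\mathbb Z_q^\times|$; $\overline p$ denotes the inverse of $p$ modulo $q$. For an integer $a$, $\epsilon_a=1$ if $a\equiv1\bmod4$ and $\epsilon_a=i$ if $a\equiv3\bmod4$. $(\frac ab)$ denotes the Jacobi symbol (for positive odd $b$, the multiplicative extension of the Legendre symbol over the prime factorization of $b$). *)

theory Defs
  imports "HOL-Analysis.Analysis" "HOL-Number_Theory.Number_Theory"
begin

definition units_mod :: "nat \<Rightarrow> nat set" where
  "units_mod q = {p \<in> {1..q}. coprime p q}"

definition inv_mod :: "nat \<Rightarrow> nat \<Rightarrow> nat" where
  "inv_mod q p = (SOME p'. p' \<in> {1..q} \<and> [p * p' = 1] (mod q))"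

definition eps4 :: "int \<Rightarrow> complex" where
  "eps4 a = (if a mod 4 = 1 then 1 else if a mod 4 = 3 then \<i> else 0)"

definition Jacobi :: "int \<Rightarrow> int \<Rightarrow> int" where
  "Jacobi a b = (\<Prod>p\<in>prime_factors b. Legendre a p ^ multiplicity p b)"

text \<open>Functions on T^2 = (R/Z)^2 are represented as 1-periodic functions on R^2.\<close>
definition torus_continuous :: "(real \<times> real \<Rightarrow> complex) \<Rightarrow> bool" where
  "torus_continuous f \<longleftrightarrow> continuous_on UNIV f \<and>
     (\<forall>x y. f (x + 1, y) = f (x, y) \<and> f (x, y + 1) = f (x, y))"

definition kl_avg :: "(real \<times> real \<Rightarrow> complex) \<Rightarrow> (nat \<Rightarrow> bool) \<Rightarrow> nat \<Rightarrow> nat \<Rightarrow> complex" where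
  "kl_avg f P q t = (1 / of_nat (totient q)) *
     (\<Sum>p\<in>{p \<in> units_mod q. P p}. f (real p / real q, real (t * inv_mod q p) / real q))"

end

theory Submission
  imports Defs "HOL-Computational_Algebra.Nth_Powers"
begin

text \<open>
  By Stone-Weierstrass it suffices to treat the functions \<open>e(m x + n y)\<close>, and each of the conditions
  on \<open>p\<close> is detected by a linear combination of real characters \<open>\<psi>\<close> modulo \<open>q\<close> in which all but the
  first are nontrivial (for \<open>q\<close> divisible by 4 this uses quadratic reciprocity for the Jacobi symbol,
  which makes \<open>p \<mapsto> (q/p)\<close> periodic). What remains is to show that the twisted Kloosterman sums
  \<open>S(a, b) = \<Sum>\<^sub>p \<psi>(p) e((a p + b p\<inverse>) / q)\<close> are \<open>o(\<phi>(q))\<close> at \<open>(m, n t)\<close>.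

  Instead of Weil's bound we use Kloosterman's fourth moment argument. The absolute value of \<open>S\<close> is
  invariant under \<open>(a, b) \<mapsto> (a u, b u\<inverse>)\<close>, so \<open>\<phi>(q) |S(m, n t)|\<^sup>4\<close> is at most \<open>|m| + |n|\<close> times the sum of
  \<open>|S(a, b)|\<^sup>4\<close> over all \<open>a, b\<close> modulo \<open>q\<close>. By orthogonality the latter is \<open>q\<^sup>2\<close> times the number of
  solutions of \<open>p\<^sub>1 + p\<^sub>2 = p\<^sub>3 + p\<^sub>4\<close>, \<open>p\<^sub>1\<inverse> + p\<^sub>2\<inverse> = p\<^sub>3\<inverse> + p\<^sub>4\<inverse>\<close>, which force
  \<open>(p\<^sub>1 - p\<^sub>3) (p\<^sub>2 - p\<^sub>3) (p\<^sub>1 + p\<^sub>2) = 0\<close>; hence there are at most \<open>2 d(q)\<^sup>2 q\<^sup>2\<close> of them, and the divisor bound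
  \<open>d(q) = O(q\<^bsup>1/8\<^esup>)\<close> together with \<open>q \<le> d(q) \<phi>(q)\<close> suffices.
\<close>

section \<open>Trigonometric polynomials on the torus\<close>

definition torus_char :: "int \<Rightarrow> int \<Rightarrow> real \<times> real \<Rightarrow> complex" where
  "torus_char m n z = cis (2 * pi * (of_int m * fst z + of_int n * snd z))"

inductive trig_poly :: "(real \<times> real \<Rightarrow> complex) \<Rightarrow> bool" where
  char: "trig_poly (torus_char m n)"
| add: "trig_poly f \<Longrightarrow> trig_poly g \<Longrightarrow> trig_poly (\<lambda>z. f z + g z)"
| scale: "trig_poly f \<Longrightarrow> trig_poly (\<lambda>z. c * f z)"

lemma torus_char_mult: "torus_char m n z * torus_char m' n' z = torus_char (m + m') (n + n') z"
  by (simp add: torus_char_def cis_mult algebra_simps)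

lemma torus_char_uminus: "torus_char (-m) (-n) z = cnj (torus_char m n z)"
  by (simp add: torus_char_def cis_cnj algebra_simps)

lemma trig_poly_const: "trig_poly (\<lambda>z. c)"
  using trig_poly.scale[OF trig_poly.char[of 0 0], of c] by (simp add: torus_char_def)

lemma trig_poly_mult:
  assumes "trig_poly f" "trig_poly g"
  shows "trig_poly (\<lambda>z. f z * g z)"
  using assms(1)
proof induction
  case (char m n)
  from assms(2) show ?case
  proof induction
    case (char m' n')
    then show ?case using trig_poly.char by (simp add: torus_char_mult)
  next
    case (add f g)
    then show ?case using trig_poly.add by (simp add: distrib_left)
  next
    case (scale f c)
    then show ?case using trig_poly.scale[of _ c] by (simp add: mult.left_commute)
  qed
next
  case (add f g)
  then show ?case using trig_poly.add by (simp add: distrib_right)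
next
  case (scale f c)
  then show ?case using trig_poly.scale[of _ c] by (simp add: mult.assoc)
qed

lemma continuous_on_trig_poly: "trig_poly f \<Longrightarrow> continuous_on A f"
  by (induction rule: trig_poly.induct)
     (auto simp: torus_char_def[abs_def] intro!: continuous_intros)

text \<open>Realises the torus as a compact subset of C^2, the setting in which Stone-Weierstrass
  for polynomial functions applies.\<close>

definition torus_embed :: "real \<times> real \<Rightarrow> complex \<times> complex" where
  "torus_embed z = (cis (2 * pi * fst z), cis (2 * pi * snd z))"

text \<open>Trigonometric polynomials are closed under sums and products, so only linear
  \<open>h\<close> carries content. A real-linear functional on C^2 is determined on the basis
  \<open>(1, 0)\<close>, \<open>(\<i>, 0)\<close>, \<open>(0, 1)\<close>, \<open>(0, \<i>)\<close>,
  hence becomes a combination of sines and cosines of the two coordinates, and these are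
  combinations of a character and its conjugate.\<close>

lemma trig_poly_real_polynomial:
  assumes "real_polynomial_function h"
  shows "trig_poly (\<lambda>z. of_real (h (torus_embed z)))"
  using assms
proof induction
  case (linear h)
  then interpret bounded_linear h .
  have cos: "of_real (cos (2 * pi * (of_int m * fst z + of_int n * snd z)))
      = 1/2 * (torus_char m n z + torus_char (-m) (-n) z)" for m n z
    unfolding torus_char_uminus by (simp add: torus_char_def complex_eq_iff)
  have sin: "of_real (sin (2 * pi * (of_int m * fst z + of_int n * snd z)))
      = -\<i>/2 * (torus_char m n z + (-1) * torus_char (-m) (-n) z)" for m n z
    unfolding torus_char_uminus by (simp add: torus_char_def complex_eq_iff)
  have decomp: "h (torus_embed z) = cos (2 * pi * fst z) * h (1, 0) + sin (2 * pi * fst z) * h (\<i>, 0)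
      + cos (2 * pi * snd z) * h (0, 1) + sin (2 * pi * snd z) * h (0, \<i>)" for z
  proof -
    have "torus_embed z = cos (2 * pi * fst z) *\<^sub>R (1, 0) + sin (2 * pi * fst z) *\<^sub>R (\<i>, 0)
      + cos (2 * pi * snd z) *\<^sub>R (0, 1) + sin (2 * pi * snd z) *\<^sub>R (0, \<i>)"
      by (simp add: torus_embed_def complex_eq_iff)
    then show ?thesis by (simp only: add scale real_scaleR_def)
  qed
  have tc: "trig_poly (\<lambda>z. of_real (cos (2 * pi * (of_int m * fst z + of_int n * snd z))))" for m n
    unfolding cos by (intro trig_poly.intros)
  have ts: "trig_poly (\<lambda>z. of_real (sin (2 * pi * (of_int m * fst z + of_int n * snd z))))" for m n
    unfolding sin by (intro trig_poly.intros)
  show ?case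
    unfolding decomp of_real_add of_real_mult[of _ "h _"]
    using tc[of 1 0] ts[of 1 0] tc[of 0 1] ts[of 0 1]
    by (intro trig_poly.add trig_poly_mult trig_poly_const) simp_all
next
  case (const c)
  then show ?case by (rule trig_poly_const)
next
  case (add f g)
  then show ?case using trig_poly.add by simp
next
  case (mult f g)
  then show ?case using trig_poly_mult by simp
qed

lemma cis_two_pi_eqD:
  assumes "cis (2 * pi * x) = cis (2 * pi * y)"
  obtains k :: int where "x = y + of_int k"
proof -
  have "cis (2 * pi * x - 2 * pi * y) = 1"
    using assms by (simp flip: cis_divide)
  then have "cos (2 * pi * x - 2 * pi * y) = 1"
    by (metis cis.sel(1) one_complex.sel(1))
  then obtain k :: int where "2 * pi * x - 2 * pi * y = of_int k * 2 * pi"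
    using cos_one_2pi_int by auto
  then have "pi * x = pi * (y + of_int k)" by (simp add: algebra_simps)
  then have "x = y + of_int k" by simp
  then show ?thesis by (rule that)
qed

lemma periodic_of_int:
  fixes g :: "real \<Rightarrow> 'a"
  assumes "\<And>x. g (x + 1) = g x"
  shows "g (x + of_int k) = g x"
proof (induction k rule: int_induct[of _ 0])
  case (step1 i)
  then show ?case using assms[of "x + of_int i"] by (simp add: add.assoc)
next
  case (step2 i)
  then show ?case using assms[of "x + of_int i - 1"] by (simp add: algebra_simps)
qed simp

text \<open>Points with the same image differ by an integer vector, so periodicity lets
  \<open>f\<close> descend to the embedded torus.\<close>

lemma torus_continuous_embed_eq:
  assumes "torus_continuous f" "torus_embed z = torus_embed w"
  shows "f z = f w"
proof -
  obtain k where k: "fst z = fst w + of_int k"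
    using assms(2) by (auto simp: torus_embed_def elim: cis_two_pi_eqD)
  obtain l where l: "snd z = snd w + of_int l"
    using assms(2) by (auto simp: torus_embed_def elim: cis_two_pi_eqD)
  have "f z = f (fst w + of_int k, snd w + of_int l)"
    by (metis k l prod.collapse)
  also have "\<dots> = f (fst w, snd w + of_int l)"
    using assms(1) periodic_of_int[of "\<lambda>x. f (x, snd w + of_int l)"]
    by (simp add: torus_continuous_def)
  also have "\<dots> = f w"
    using assms(1) periodic_of_int[of "\<lambda>y. f (fst w, y)"]
    by (simp add: torus_continuous_def)
  finally show ?thesis .
qed

lemma cis_frac: "cis (2 * pi * frac x) = cis (2 * pi * x)"
proof -
  have "cis (2 * pi * x) = cis (2 * pi * frac x + 2 * pi * of_int \<lfloor>x\<rfloor>)"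
    by (simp add: frac_def algebra_simps)
  also have "\<dots> = cis (2 * pi * frac x)"
    by (simp only: flip: cis_mult) (simp add: cis_multiple_2pi)
  finally show ?thesis by simp
qed

lemma trig_poly_dense:
  assumes f: "torus_continuous f" and e: "e > 0"
  obtains g where "trig_poly g" "\<And>z. norm (f z - g z) < e"
proof -
  define B where "B = cbox (0 :: real, 0 :: real) (1, 1)"
  \<comment> \<open>The choice of the preimage is immaterial by periodicity, so \<open>F\<close> is
    \<open>f\<close> transported to the embedded torus.\<close>
  define F where "F w = f (SOME z. torus_embed z = w)" for w
  have F: "F (torus_embed z) = f z" for z
    unfolding F_def by (rule torus_continuous_embed_eq[OF f]) (rule someI_ex, blast)
  have cont: "continuous_on UNIV f" using f by (simp add: torus_continuous_def)
  have cE: "continuous_on A torus_embed" for A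
    unfolding torus_embed_def by (intro continuous_intros)
  \<comment> \<open>Taking fractional parts shows that the unit square already covers the whole
    image, which is therefore compact.\<close>
  have range: "torus_embed z \<in> torus_embed ` B" for z
  proof
    show "torus_embed z = torus_embed (frac (fst z), frac (snd z))"
      by (simp add: torus_embed_def cis_frac)
    show "(frac (fst z), frac (snd z)) \<in> B"
      by (simp add: B_def cbox_Pair_eq frac_lt_1 less_imp_le)
  qed
  have S: "compact (torus_embed ` B)"
    unfolding B_def by (intro compact_continuous_image cE compact_cbox)
  \<comment> \<open>The preimage of a closed set under \<open>F\<close> is the image of a compact
    part of the square, hence compact and closed; no continuous section of the embedding is
    required.\<close>
  have "continuous_on (torus_embed ` B) F"
    unfolding continuous_on_closed_vimage[OF compact_imp_closed[OF S]]
  proof (intro allI impI)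
    fix C :: "complex set" assume "closed C"
    have "F -` C \<inter> torus_embed ` B = torus_embed ` (B \<inter> f -` C)"
      using F by auto
    moreover have "compact (B \<inter> f -` C)"
      unfolding B_def
      by (intro compact_Int_closed compact_cbox continuous_closed_vimage[OF \<open>closed C\<close>])
         (metis UNIV_I cont continuous_on_eq_continuous_at open_UNIV)
    ultimately show "closed (F -` C \<inter> torus_embed ` B)"
      by (metis compact_imp_closed compact_continuous_image cE)
  qed
  from Stone_Weierstrass_polynomial_function[OF S this e]
  obtain h where h: "polynomial_function h" "\<forall>w\<in>torus_embed ` B. norm (F w - h w) < e"
    by (elim exE conjE)
  have "real_polynomial_function (\<lambda>w. Re (h w))" "real_polynomial_function (\<lambda>w. Im (h w))"
    using h(1) bounded_linear_Re bounded_linear_Im by (auto simp: polynomial_function_def o_def)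
  from this[THEN trig_poly_real_polynomial]
  have "trig_poly (\<lambda>z. of_real (Re (h (torus_embed z))) + \<i> * of_real (Im (h (torus_embed z))))"
    by (rule trig_poly.add[OF _ trig_poly.scale])
  then have "trig_poly (\<lambda>z. h (torus_embed z))"
    by (simp only: complex_eq[symmetric])
  moreover have "norm (f z - h (torus_embed z)) < e" for z
    using bspec[OF h(2) range] F by simp
  ultimately show ?thesis by (rule that)
qed

text \<open>The phase \<open>c\<close> absorbs the other coordinate, so that the same formula serves
  both steps of the iterated integral.\<close>

lemma integral_cis_period:
  fixes m :: int
  shows "integral (cbox 0 1) (\<lambda>x. cis (2 * pi * (of_int m * x + c))) = (if m = 0 then cis (2 * pi * c) else 0)"
proof (cases "m = 0")
  case False
  define G where "G x = cis (2 * pi * (of_int m * x + c)) / (2 * pi * of_int m * \<i>)" for x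
  have "((\<lambda>x. cis (2 * pi * (of_int m * x + c))) has_integral (G 1 - G 0)) {0..1}"
  proof (rule fundamental_theorem_of_calculus)
    fix x :: real
    have "((\<lambda>x. exp (\<i> * (2 * of_real pi * (of_int m * of_real x + of_real c))) / (2 * of_real pi * of_int m * \<i>))
        has_vector_derivative exp (\<i> * (2 * of_real pi * (of_int m * of_real x + of_real c)))) (at x within {0..1})"
      by (rule has_vector_derivative_real_field)
         (use False in \<open>auto intro!: derivative_eq_intros\<close>)
    then show "(G has_vector_derivative cis (2 * pi * (of_int m * x + c))) (at x within {0..1})"
      by (simp add: G_def[abs_def] cis_conv_exp)
  qed simp
  moreover have "G 1 = G 0"
    by (simp add: G_def distrib_left cis_multiple_2pi flip: cis_mult)
  ultimately show ?thesis using False by (simp add: integral_unique)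
qed simp

lemma integral_torus_char:
  "integral (cbox (0, 0) (1, 1)) (torus_char m n) = (if m = 0 \<and> n = 0 then 1 else 0)"
proof -
  have "integral (cbox (0, 0) (1, 1)) (torus_char m n)
      = integral (cbox 0 1) (\<lambda>x. integral (cbox 0 1) (\<lambda>y. torus_char m n (x, y)))"
    by (rule integral_prod_continuous) (rule continuous_on_trig_poly[OF trig_poly.char])
  also have "\<dots> = integral (cbox 0 1) (\<lambda>x. if n = 0 then cis (2 * pi * (of_int m * x)) else 0)"
    using integral_cis_period[of n] by (simp add: torus_char_def add.commute)
  also have "\<dots> = (if m = 0 \<and> n = 0 then 1 else 0)"
    using integral_cis_period[of m 0] by (cases "n = 0") auto
  finally show ?thesis .
qed

section \<open>Divisor bounds and counting solutions of congruences\<close>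

text \<open>The interval splits into \<open>K\<close> blocks of length \<open>d\<close>, each
  containing at most one member of the residue class. The shift \<open>w - 1\<close> aligns the
  blocks with an interval starting at 1.\<close>

lemma card_cong_interval_le:
  assumes "d > 0"
  shows "card {w \<in> {1..d * K}. [int w = c] (mod int d)} \<le> K"
proof -
  let ?S = "{w \<in> {1..d * K}. [int w = c] (mod int d)}"
  have "inj_on (\<lambda>w. (w - 1) div d) ?S"
  proof (rule inj_onI)
    fix v w assume v: "v \<in> ?S" and w: "w \<in> ?S" and eq: "(v - 1) div d = (w - 1) div d"
    have "[int v = int w] (mod int d)"
      using v w cong_trans cong_sym by blast
    then have "[v - 1 = w - 1] (mod d)"
      using v w by (simp add: cong_int_iff cong_diff_nat)
    then have "v - 1 = w - 1"
      using eq by (metis cong_def div_mult_mod_eq)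
    then show "v = w" using v w by auto
  qed
  moreover have "(\<lambda>w. (w - 1) div d) ` ?S \<subseteq> {..<K}"
    using assms by (auto simp: less_mult_imp_div_less mult.commute)
  ultimately show ?thesis
    using card_inj_on_le[of _ ?S "{..<K}"] by simp
qed

section \<open>Bounds for the number of divisors\<close>

lemma divisor_count_mult_prime_power_le:
  fixes p m :: nat
  assumes "prime p" "m > 0"
  shows "card {d. d dvd p ^ a * m} \<le> (a + 1) * card {d. d dvd m}"
proof -
  have "{d. d dvd p ^ a * m} \<subseteq> (\<lambda>(i, d). p ^ i * d) ` ({..a} \<times> {d. d dvd m})"
  proof
    fix d assume "d \<in> {d. d dvd p ^ a * m}"
    then obtain b c where "d = b * c" "b dvd p ^ a" "c dvd m"
      using division_decomp[of d "p ^ a" m] by auto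
    moreover from this obtain i where "i \<le> a" "b = p ^ i"
      using assms(1) by (auto simp: divides_primepow_nat)
    ultimately show "d \<in> (\<lambda>(i, d). p ^ i * d) ` ({..a} \<times> {d. d dvd m})"
      by auto
  qed
  moreover have "finite ({..a} \<times> {d. d dvd m})" using assms by simp
  ultimately have "card {d. d dvd p ^ a * m} \<le> card ({..a} \<times> {d. d dvd m})"
    by (rule surj_card_le[rotated])
  then show ?thesis by (simp add: card_cartesian_product)
qed

text \<open>Division with remainder gives \<open>a + 1 \<le> k * (a div k + 1)\<close>, and the
  second factor is at most \<open>2 ^ (a div k)\<close>. This caps by \<open>k ^ k\<close> the cost
  of a small prime in the divisor bound.\<close>

lemma Suc_power_le_two_power:
  assumes "k > 0"
  shows "(a + 1) ^ k \<le> k ^ k * 2 ^ (a :: nat)"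
proof -
  have "a + 1 \<le> k * (a div k + 1)"
  proof -
    have "a = k * (a div k) + a mod k" by simp
    moreover have "a mod k < k" using assms by simp
    ultimately show ?thesis unfolding distrib_left by linarith
  qed
  also have "\<dots> \<le> k * 2 ^ (a div k)"
    using Suc_leI[OF less_exp[of "a div k"]] by (intro mult_left_mono) simp_all
  finally have "(a + 1) ^ k \<le> (k * 2 ^ (a div k)) ^ k" by (rule power_mono) simp
  also have "\<dots> = k ^ k * 2 ^ (a div k * k)" by (simp add: power_mult_distrib power_mult)
  also have "\<dots> \<le> k ^ k * 2 ^ a" by (intro mult_left_mono power_increasing) auto
  finally show ?thesis .
qed

text \<open>Splitting off a full prime power \<open>p ^ a\<close> costs a factor
  \<open>(a + 1) ^ k\<close>. It is at most \<open>p ^ a\<close> when \<open>p \<ge> 2 ^ k\<close>,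
  so that only the primes below \<open>2 ^ k\<close> contribute an extra factor
  \<open>k ^ k\<close>.\<close>

lemma divisor_count_power_le:
  fixes n :: nat
  assumes "n > 0" "k > 0"
  shows "card {d. d dvd n} ^ k \<le> (k ^ k) ^ card {p \<in> prime_factors n. p < 2 ^ k} * n"
  using assms(1)
proof (induction n rule: less_induct)
  case (less n)
  show ?case
  proof (cases "n = 1")
    case False
    then obtain p where p: "prime p" "p dvd n" using prime_factor_nat by blast
    define a where "a = multiplicity p n"
    obtain m where m: "n = p ^ a * m" "\<not> p dvd m"
      using multiplicity_decompose'[of n p] less.prems p(1) not_prime_unit unfolding a_def by blast
    have "m > 0" using less.prems m by (cases m) auto
    have "a > 0" using p less.prems unfolding a_def by (simp add: prime_multiplicity_gt_zero_iff)
    have "p > 1" using p(1) prime_gt_1_nat by blast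
    then have "1 < p ^ a" using \<open>a > 0\<close> by (rule one_less_power)
    then have "m < n" using \<open>m > 0\<close> m(1) by simp
    have pf: "prime_factors n = insert p (prime_factors m)"
      using m \<open>m > 0\<close> p(1) \<open>a > 0\<close> \<open>p > 1\<close>
      by (auto simp: prime_factors_product prime_factors_power prime_prime_factors)
    have pm: "p \<notin> prime_factors m" using m(2) by auto
    let ?P = "\<lambda>n. {p \<in> prime_factors n. p < 2 ^ k}"
    have "card {d. d dvd n} ^ k \<le> ((a + 1) * card {d. d dvd m}) ^ k"
      unfolding m(1) by (intro power_mono divisor_count_mult_prime_power_le p \<open>m > 0\<close>) simp
    also have "\<dots> = (a + 1) ^ k * card {d. d dvd m} ^ k" by (rule power_mult_distrib)
    also have "\<dots> \<le> (a + 1) ^ k * ((k ^ k) ^ card (?P m) * m)"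
      by (intro mult_left_mono less.IH \<open>m < n\<close> \<open>m > 0\<close>) simp
    also have "\<dots> \<le> (k ^ k) ^ card (?P n) * n"
    proof (cases "p < 2 ^ k")
      case True
      have "?P n = insert p (?P m)" using pf True by auto
      then have "card (?P n) = Suc (card (?P m))" using pm by simp
      moreover have "(a + 1) ^ k \<le> k ^ k * p ^ a"
      proof -
        have "(a + 1) ^ k \<le> k ^ k * 2 ^ a" by (rule Suc_power_le_two_power[OF \<open>k > 0\<close>])
        also have "\<dots> \<le> k ^ k * p ^ a"
          using \<open>p > 1\<close> by (intro mult_left_mono power_mono) auto
        finally show ?thesis .
      qed
      ultimately show ?thesis
        using mult_right_mono[of "(a + 1) ^ k" "k ^ k * p ^ a" "(k ^ k) ^ card (?P m) * m"] m(1)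
        by (simp add: algebra_simps)
    next
      case False
      have "?P n = ?P m" using pf False by auto
      moreover have "(a + 1) ^ k \<le> p ^ a"
      proof -
        have "a + 1 \<le> 2 ^ a" using Suc_leI[OF less_exp[of a]] by simp
        then have "(a + 1) ^ k \<le> (2 ^ a) ^ k" by (rule power_mono) simp
        also have "\<dots> = (2 ^ k) ^ a" by (metis mult.commute power_mult)
        also have "\<dots> \<le> p ^ a" using False by (intro power_mono) auto
        finally show ?thesis .
      qed
      ultimately show ?thesis
        using mult_right_mono[of "(a + 1) ^ k" "p ^ a" "(k ^ k) ^ card (?P m) * m"] m(1)
        by (simp add: algebra_simps)
    qed
    finally show ?thesis .
  qed simp
qed

text \<open>There are at most \<open>2 ^ k\<close> primes below \<open>2 ^ k\<close>, whatever
  \<open>n\<close> is, so the product of the extra factors is bounded by a constant.\<close>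

lemma divisor_count_bound:
  assumes "k > 0"
  obtains C :: nat where "\<And>n. n > 0 \<Longrightarrow> card {d. d dvd n} ^ k \<le> C * n"
proof
  fix n :: nat assume "n > 0"
  have "card {p \<in> prime_factors n. p < 2 ^ k} \<le> card {..<2 ^ k :: nat}"
    by (rule card_mono) auto
  then have "(k ^ k) ^ card {p \<in> prime_factors n. p < 2 ^ k} \<le> (k ^ k) ^ 2 ^ k"
    using assms by (intro power_increasing) auto
  then show "card {d. d dvd n} ^ k \<le> (k ^ k) ^ 2 ^ k * n"
    using divisor_count_power_le[OF \<open>n > 0\<close> assms] by (meson le_trans mult_le_mono1)
qed

text \<open>In Gauss's identity for the sum of \<open>totient d\<close> over the divisors of
  \<open>q\<close>, every term is at most \<open>totient q\<close>.\<close>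

lemma le_divisor_count_mult_totient:
  assumes "q > 0"
  shows "q \<le> card {d. d dvd q} * totient q"
proof -
  have "q = (\<Sum>d | d dvd q. totient d)" by (simp add: totient_divisor_sum)
  also have "\<dots> \<le> of_nat (card {d. d dvd q}) * totient q"
    by (rule sum_bounded_above) (use assms in \<open>auto intro: totient_dvd_mono\<close>)
  finally show ?thesis by simp
qed

section \<open>Counting triples with a product divisible by \<open>q\<close>\<close>

lemma card_Sigma_le:
  assumes "finite A" "card A \<le> m" "\<And>x. x \<in> A \<Longrightarrow> finite (B x)" "\<And>x. x \<in> A \<Longrightarrow> card (B x) \<le> n"
  shows "card (Sigma A B) \<le> m * n"
proof -
  have "card (Sigma A B) = (\<Sum>x\<in>A. card (B x))" using assms by (intro card_SigmaI) auto
  also have "\<dots> \<le> of_nat (card A) * n" by (rule sum_bounded_above) (use assms in auto)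
  also have "\<dots> \<le> m * n" using assms by simp
  finally show ?thesis .
qed

text \<open>By Bezout a factor may be replaced by its gcd with \<open>q\<close>. Two of the factors
  thereby become divisors of \<open>q\<close>, of which there are few.\<close>

lemma dvd_product_of_gcd:
  fixes q x y z :: int
  assumes "q dvd x * y * z"
  shows "q dvd gcd x q * gcd y q * z"
proof -
  have *: "q dvd gcd a q * c" if "q dvd a * c" for a c :: int
  proof -
    obtain u v where "u * a + v * q = gcd a q" using bezout_int by blast
    then have "gcd a q * c = u * (a * c) + q * (v * c)" by (metis distrib_right mult.assoc mult.commute)
    then show ?thesis using that by simp
  qed
  have "q dvd gcd x q * (y * z)" by (rule *) (use assms in \<open>simp add: mult.assoc\<close>)
  then have "q dvd gcd y q * (gcd x q * z)" by (intro *) (simp add: ac_simps)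
  then show ?thesis by (simp add: ac_simps)
qed

text \<open>A triple is encoded by the residues of \<open>p1 - p3\<close> and \<open>p2 - p3\<close>
  together with \<open>2 * p3\<close>. The first two are confined to classes modulo
  \<open>d1\<close> and \<open>d2\<close>, leaving \<open>q / d1\<close> and \<open>q / d2\<close>
  choices. Since \<open>p1 + p2\<close> vanishes modulo \<open>e = q / gcd q (d1 * d2)\<close>, they
  determine \<open>2 * p3\<close> modulo \<open>e\<close>, which leaves at most
  \<open>2 * d1 * d2\<close> choices.\<close>

lemma card_triples_fixed_divisors_le:
  fixes q d1 d2 :: nat
  assumes q: "q > 0" and d: "d1 dvd q" "d2 dvd q"
  shows "card {(p1, p2, p3). p1 \<in> {1..q} \<and> p2 \<in> {1..q} \<and> p3 \<in> {1..q} \<and>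
      int d1 dvd int p1 - int p3 \<and> int d2 dvd int p2 - int p3 \<and>
      int q dvd int d1 * int d2 * (int p1 + int p2)} \<le> 2 * q ^ 2" (is "card ?T \<le> _")
proof -
  define h where "h = gcd q (d1 * d2)"
  define e where "e = q div h"
  have e: "q = e * h" unfolding e_def h_def by simp
  obtain k1 k2 where k: "q = d1 * k1" "q = d2 * k2" using d unfolding dvd_def by blast
  have pos: "d1 > 0" "d2 > 0" "e > 0" "h > 0" using q k e by (auto intro!: Nat.gr0I)
  \<comment> \<open>The shift by 1 places the representative in \<open>{1..q}\<close>; accordingly
    the classes below are those of 1 instead of 0.\<close>
  define R where "R p r = nat ((int p - int r) mod int q) + 1" for p r
  have R_cong: "[int (R p r) = int p - int r + 1] (mod int q)" for p r
    using q by (simp add: R_def cong_def mod_simps add.commute)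
  have R_mem: "R p r \<in> {1..q}" for p r
    using q by (simp add: R_def) (metis Suc_leI nat_less_iff of_nat_0_less_iff pos_mod_bound pos_mod_sign)
  define X where "X = {w \<in> {1..d1 * k1}. [int w = 1] (mod int d1)}"
  define Y where "Y = {w \<in> {1..d2 * k2}. [int w = 1] (mod int d2)}"
  define W where "W x y = {w \<in> {1..e * (2 * h)}. [int w = 2 - int x - int y] (mod int e)}" for x y
  \<comment> \<open>The last coordinate is the integer \<open>2 * p3\<close> in \<open>{1..2 * q}\<close>, not its residue modulo \<open>q\<close>, so that
    the map stays injective for even \<open>q\<close>.\<close>
  let ?f = "\<lambda>(p1, p2, p3). (R p1 p3, R p2 p3, 2 * p3)"
  have "inj_on ?f ?T"
  proof (rule inj_onI, clarsimp)
    have *: "p = p'" if "R p r = R p' r" "p \<in> {1..q}" "p' \<in> {1..q}" for p p' r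
    proof -
      have "[int p - int r + 1 = int p' - int r + 1] (mod int q)"
        using R_cong[of p r] R_cong[of p' r] that(1) by (metis cong_sym cong_trans)
      then have "[int p - int p' = 0] (mod int q)"
        by (simp add: cong_iff_dvd_diff)
      then have "int q dvd int p - int p'" by (simp add: cong_0_iff)
      moreover have "\<bar>int p - int p'\<bar> < int q" using that by auto
      ultimately have "int p - int p' = 0" using zdvd_imp_le by (metis dvd_abs_iff linorder_not_less zero_less_abs_iff)
      then show ?thesis by simp
    qed
    fix p1 p2 p3 p1' p2'
    assume "R p1 p3 = R p1' p3" "R p2 p3 = R p2' p3" "Suc 0 \<le> p1" "p1 \<le> q" "Suc 0 \<le> p2" "p2 \<le> q"
      "Suc 0 \<le> p1'" "p1' \<le> q" "Suc 0 \<le> p2'" "p2' \<le> q"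
    then show "p1 = p1' \<and> p2 = p2'" using *[of p1 p3 p1'] *[of p2 p3 p2'] by simp
  qed
  moreover have "?f ` ?T \<subseteq> (SIGMA x:X. SIGMA y:Y. W x y)"
  proof (rule image_subsetI)
    fix z assume "z \<in> ?T"
    then obtain p1 p2 p3 where z: "z = (p1, p2, p3)"
      and p: "p1 \<in> {1..q}" "p2 \<in> {1..q}" "p3 \<in> {1..q}"
      and d1: "int d1 dvd int p1 - int p3" and d2: "int d2 dvd int p2 - int p3"
      and s: "int q dvd int d1 * int d2 * (int p1 + int p2)"
      by blast
    have "[int (R p1 p3) = int p1 - int p3 + 1] (mod int d1)"
      using R_cong d(1) cong_dvd_modulus by (metis of_nat_dvd_iff)
    moreover have "[int p1 - int p3 + 1 = 1] (mod int d1)"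
      using d1 by (simp add: cong_iff_dvd_diff)
    ultimately have inX: "R p1 p3 \<in> X"
      unfolding X_def using R_mem k(1) cong_trans by auto
    have "[int (R p2 p3) = int p2 - int p3 + 1] (mod int d2)"
      using R_cong d(2) cong_dvd_modulus by (metis of_nat_dvd_iff)
    moreover have "[int p2 - int p3 + 1 = 1] (mod int d2)"
      using d2 by (simp add: cong_iff_dvd_diff)
    ultimately have inY: "R p2 p3 \<in> Y"
      unfolding Y_def using R_mem k(2) cong_trans by auto
    \<comment> \<open>Dividing \<open>q\<close> and \<open>d1 * d2\<close> by their gcd leaves
      coprime cofactors, so the divisibility of the product reduces to \<open>e\<close> dividing
      \<open>p1 + p2\<close>.\<close>
    define d' where "d' = (d1 * d2) div h"
    have d': "d1 * d2 = h * d'" by (simp add: d'_def h_def)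
    have "coprime e d'"
      unfolding e_def d'_def h_def using q by (intro div_gcd_coprime) simp
    have "int e * int h dvd int h * int d' * (int p1 + int p2)"
      using s by (simp add: e d' flip: of_nat_mult)
    then have "int e dvd int d' * (int p1 + int p2)"
      using pos by (simp add: mult.commute[of "int e"] mult.assoc)
    then have edvd: "int e dvd int p1 + int p2"
      using \<open>coprime e d'\<close> by (simp add: coprime_dvd_mult_right_iff)
    have "int e dvd int q" using e by simp
    then have "[int (R p1 p3) = int p1 - int p3 + 1] (mod int e)" "[int (R p2 p3) = int p2 - int p3 + 1] (mod int e)"
      using R_cong cong_dvd_modulus by blast+
    \<comment> \<open>The two shifts by 1 cancel against the 2, and what remains is
      \<open>2 * p3\<close> minus the multiple \<open>p1 + p2\<close> of \<open>e\<close>.\<close>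
    then have "[2 - int (R p1 p3) - int (R p2 p3)
        = 2 - (int p1 - int p3 + 1) - (int p2 - int p3 + 1)] (mod int e)"
      by (intro cong_diff cong_refl)
    also have "2 - (int p1 - int p3 + 1) - (int p2 - int p3 + 1) = int (2 * p3) - (int p1 + int p2)"
      by simp
    also have "[int (2 * p3) - (int p1 + int p2) = int (2 * p3)] (mod int e)"
      using edvd dvd_minus_iff[of "int e" "int p1 + int p2"] by (simp add: cong_iff_dvd_diff)
    finally have "2 * p3 \<in> W (R p1 p3) (R p2 p3)"
      unfolding W_def using p(3) e by (auto simp: cong_sym)
    then show "?f z \<in> (SIGMA x:X. SIGMA y:Y. W x y)"
      using inX inY by (simp add: z)
  qed
  moreover have fin: "finite X" "finite Y" "\<And>x y. finite (W x y)" by (auto simp: X_def Y_def W_def)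
  ultimately have "card ?T \<le> card (SIGMA x:X. SIGMA y:Y. W x y)"
    by (intro card_inj_on_le[of ?f]) auto
  also have "\<dots> \<le> k1 * (k2 * (2 * h))"
    using fin pos unfolding X_def Y_def W_def
    by (intro card_Sigma_le card_cong_interval_le) auto
  also have "\<dots> \<le> k1 * (k2 * (2 * (d1 * d2)))"
    using pos by (intro mult_left_mono) (auto simp: h_def intro!: gcd_le2_nat)
  also have "\<dots> = 2 * ((d1 * k1) * (d2 * k2))" by simp
  also have "\<dots> = 2 * q ^ 2" using k by (simp add: power2_eq_square)
  finally show ?thesis .
qed

text \<open>The triples are sorted by the gcds of \<open>p1 - p3\<close> and \<open>p2 - p3\<close>
  with \<open>q\<close>, a pair of divisors of \<open>q\<close>; each pair accounts for at most
  \<open>2 * q ^ 2\<close> triples.\<close>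

lemma card_triples_le:
  fixes q :: nat
  assumes q: "q > 0"
  shows "card {(p1, p2, p3). p1 \<in> {1..q} \<and> p2 \<in> {1..q} \<and> p3 \<in> {1..q} \<and>
      int q dvd (int p1 - int p3) * (int p2 - int p3) * (int p1 + int p2)}
      \<le> 2 * card {d. d dvd q} ^ 2 * q ^ 2" (is "card ?T \<le> _")
proof -
  let ?D = "{d. d dvd q}"
  define T where "T d = {(p1, p2, p3). p1 \<in> {1..q} \<and> p2 \<in> {1..q} \<and> p3 \<in> {1..q} \<and>
      int (fst d) dvd int p1 - int p3 \<and> int (snd d) dvd int p2 - int p3 \<and>
      int q dvd int (fst d) * int (snd d) * (int p1 + int p2)}" for d
  have fin: "finite (T d)" for d
    by (rule finite_subset[of _ "{1..q} \<times> {1..q} \<times> {1..q}"]) (auto simp: T_def)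
  have finD: "finite ?D" using q by simp
  have "?T \<subseteq> (\<Union>d\<in>?D \<times> ?D. T d)"
  proof (clarify)
    fix p1 p2 p3 assume p: "p1 \<in> {1..q}" "p2 \<in> {1..q}" "p3 \<in> {1..q}"
      and dv: "int q dvd (int p1 - int p3) * (int p2 - int p3) * (int p1 + int p2)"
    define d where "d = (nat (gcd (int p1 - int p3) (int q)), nat (gcd (int p2 - int p3) (int q)))"
    have "int (fst d) dvd int q" "int (snd d) dvd int q" by (simp_all add: d_def)
    then have "d \<in> ?D \<times> ?D" by (simp add: mem_Times_iff)
    moreover have "(p1, p2, p3) \<in> T d"
      using p dvd_product_of_gcd[OF dv] by (simp add: T_def d_def)
    ultimately show "(p1, p2, p3) \<in> (\<Union>d\<in>?D \<times> ?D. T d)" by blast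
  qed
  then have "card ?T \<le> card (\<Union>d\<in>?D \<times> ?D. T d)"
    by (rule card_mono[rotated]) (use fin finD in auto)
  also have "\<dots> \<le> (\<Sum>d\<in>?D \<times> ?D. card (T d))"
    using finD by (intro card_UN_le) auto
  also have "\<dots> \<le> of_nat (card (?D \<times> ?D)) * (2 * q ^ 2)"
    unfolding T_def by (rule sum_bounded_above) (use card_triples_fixed_divisors_le[OF q] in auto)
  also have "\<dots> = 2 * card ?D ^ 2 * q ^ 2"
    by (simp add: card_cartesian_product power2_eq_square)
  finally show ?thesis .
qed

section \<open>Twisted Kloosterman sums\<close>

lemma units_mod_eq_totatives: "units_mod q = totatives q"
  by (auto simp: units_mod_def totatives_def)

lemma finite_units_mod [simp]: "finite (units_mod q)"
  by (simp add: units_mod_eq_totatives)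

lemma card_units_mod: "card (units_mod q) = totient q"
  by (simp add: units_mod_eq_totatives totient_def)

text \<open>Representatives lie in \<open>{1..q}\<close>, so for \<open>q = 1\<close> the unit is 1
  whereas \<open>k mod q\<close> is 0; this is the reason for \<open>q \<ge> 2\<close> here and in
  later lemmas.\<close>

lemma mod_in_units_mod:
  assumes "q \<ge> 2" "coprime k q"
  shows "k mod q \<in> units_mod q"
proof -
  have "\<not> q dvd k" using assms coprime_common_divisor[of k q q] by auto
  then have "k mod q \<noteq> 0" by (simp add: mod_eq_0_iff_dvd)
  then show ?thesis using assms by (simp add: units_mod_def less_imp_le)
qed

lemma units_mod_cong_eq:
  assumes "p \<in> units_mod q" "p' \<in> units_mod q" "[p = p'] (mod q)"
  shows "p = p'"
proof (cases "q = 1")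
  case False
  then have "p < q" "p' < q"
    using assms by (auto simp: units_mod_def order_le_less)
  then show ?thesis using assms(3) by (simp add: cong_def)
qed (use assms in \<open>auto simp: units_mod_def\<close>)

lemma inv_mod:
  assumes "p \<in> units_mod q"
  shows inv_mod_in_units_mod: "inv_mod q p \<in> units_mod q"
    and cong_mult_inv_mod: "[p * inv_mod q p = 1] (mod q)"
proof -
  have "\<exists>p'. p' \<in> {1..q} \<and> [p * p' = 1] (mod q)"
  proof (cases "q \<ge> 2")
    case True
    obtain x where x: "[p * x = 1] (mod q)"
      using assms cong_solve_coprime_nat by (auto simp: units_mod_def)
    then have "coprime x q"
      by (metis cong_imp_coprime cong_sym coprime_1_left coprime_mult_left_iff)
    then have "x mod q \<in> {1..q}" using mod_in_units_mod[OF True] by (simp add: units_mod_def)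
    moreover have "[p * (x mod q) = 1] (mod q)" using x by (simp add: cong_def mod_simps)
    ultimately show ?thesis by blast
  next
    case False
    then have "q = 1" using assms by (auto simp: units_mod_def)
    then show ?thesis by (auto simp: cong_def)
  qed
  from someI_ex[OF this]
  have *: "inv_mod q p \<in> {1..q}" "[p * inv_mod q p = 1] (mod q)" unfolding inv_mod_def by auto
  then show "[p * inv_mod q p = 1] (mod q)" by simp
  from * show "inv_mod q p \<in> units_mod q"
    unfolding units_mod_def
    by (simp) (metis One_nat_def cong_imp_coprime cong_sym coprime_1_left coprime_mult_left_iff)
qed

lemma cong_mult_cancel_inverse:
  fixes p x y q :: nat
  assumes "[p * x = 1] (mod q)" "[p * y = 1] (mod q)"
  shows "[x = y] (mod q)"
proof -
  have "[x * (p * y) = x * 1] (mod q)" "[(p * x) * y = 1 * y] (mod q)"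
    by (rule cong_mult[OF cong_refl assms(2)], rule cong_mult[OF assms(1) cong_refl])
  then show ?thesis by (metis cong_sym cong_trans mult.assoc mult.commute mult_1 mult_1_right)
qed

lemma inj_on_inv_mod: "inj_on (inv_mod q) (units_mod q)"
proof (rule inj_onI)
  fix p p' assume p: "p \<in> units_mod q" "p' \<in> units_mod q" "inv_mod q p = inv_mod q p'"
  then have "[inv_mod q p * p = 1] (mod q)" "[inv_mod q p * p' = 1] (mod q)"
    using cong_mult_inv_mod[of p q] cong_mult_inv_mod[of p' q] by (simp_all add: mult.commute)
  then show "p = p'" using p units_mod_cong_eq cong_mult_cancel_inverse by blast
qed

lemma coprime_units_mod: "p \<in> units_mod q \<Longrightarrow> coprime p q"
  by (simp add: units_mod_def)

lemma bij_betw_mult_units_mod: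
  assumes "q \<ge> 2" "u \<in> units_mod q"
  shows "bij_betw (\<lambda>p. p * u mod q) (units_mod q) (units_mod q)"
proof -
  have "inj_on (\<lambda>p. p * u mod q) (units_mod q)"
  proof (rule inj_onI)
    fix p p' assume p: "p \<in> units_mod q" "p' \<in> units_mod q" and "p * u mod q = p' * u mod q"
    then have "[p * u = p' * u] (mod q)" by (simp add: cong_def)
    then have "[p = p'] (mod q)" using coprime_units_mod[OF assms(2)] cong_mult_rcancel_nat by blast
    then show "p = p'" using p units_mod_cong_eq by blast
  qed
  moreover have "(\<lambda>p. p * u mod q) ` units_mod q \<subseteq> units_mod q"
    using assms by (auto intro!: mod_in_units_mod simp: coprime_units_mod)
  ultimately show ?thesis by (simp add: bij_betw_def endo_inj_surj)
qed

lemma inv_mod_mult: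
  assumes "q \<ge> 2" "p \<in> units_mod q" "u \<in> units_mod q"
  shows "[inv_mod q (p * u mod q) = inv_mod q p * inv_mod q u] (mod q)"
proof (rule cong_mult_cancel_inverse)
  have "p * u mod q \<in> units_mod q"
    using assms by (auto intro!: mod_in_units_mod simp: coprime_units_mod)
  then have "[p * u mod q * inv_mod q (p * u mod q) = 1] (mod q)" by (rule cong_mult_inv_mod)
  then show "[p * u * inv_mod q (p * u mod q) = 1] (mod q)" by (simp add: cong_def mod_simps)
  have "[(p * inv_mod q p) * (u * inv_mod q u) = 1 * 1] (mod q)"
    using assms cong_mult_inv_mod by (intro cong_mult) auto
  then show "[p * u * (inv_mod q p * inv_mod q u) = 1] (mod q)" by (simp add: ac_simps)
qed

section \<open>Additive characters modulo \<open>q\<close> and orthogonality\<close>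

definition unity_root_pow :: "nat \<Rightarrow> int \<Rightarrow> complex" where
  "unity_root_pow q k = cis (2 * pi * (of_int k / of_nat q))"

lemma unity_root_pow_add: "unity_root_pow q (k + l) = unity_root_pow q k * unity_root_pow q l"
  by (simp add: unity_root_pow_def cis_mult add_divide_distrib distrib_left)

lemma unity_root_pow_uminus: "unity_root_pow q (- k) = cnj (unity_root_pow q k)"
  by (simp add: unity_root_pow_def cis_cnj)

lemma unity_root_pow_eq_1_iff:
  assumes "q > 0"
  shows "unity_root_pow q k = 1 \<longleftrightarrow> int q dvd k"
proof
  assume "unity_root_pow q k = 1"
  then have "cis (2 * pi * (of_int k / of_nat q)) = cis (2 * pi * 0)" by (simp add: unity_root_pow_def)
  then obtain j :: int where "of_int k / of_nat q = (0 + of_int j :: real)" by (rule cis_two_pi_eqD)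
  then have "real_of_int k = of_int (int q * j)" using assms by (simp add: field_simps)
  then have "k = int q * j" by (simp only: of_int_eq_iff)
  then show "int q dvd k" by simp
next
  assume "int q dvd k"
  then obtain j where "k = int q * j" by blast
  then show "unity_root_pow q k = 1" using assms by (simp add: unity_root_pow_def cis_multiple_2pi)
qed

lemma unity_root_pow_cong:
  assumes "[k = l] (mod int q)"
  shows "unity_root_pow q k = unity_root_pow q l"
proof (cases "q = 0")
  case False
  have "unity_root_pow q (k - l) = 1"
    using assms False by (simp add: unity_root_pow_eq_1_iff cong_iff_dvd_diff)
  then show ?thesis using unity_root_pow_add[of q "k - l" l] by simp
qed (use assms in \<open>simp add: cong_def\<close>)

lemma sum_unity_root_pow:
  assumes "q > 0"
  shows "(\<Sum>a<q. unity_root_pow q (int a * k)) = (if int q dvd k then of_nat q else 0)"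
proof -
  have pow: "unity_root_pow q (int a * k) = unity_root_pow q k ^ a" for a
    unfolding unity_root_pow_def Complex.DeMoivre by (intro arg_cong[of _ _ cis]) simp
  have "unity_root_pow q k ^ q = 1"
    unfolding pow[symmetric] using assms by (simp add: unity_root_pow_eq_1_iff)
  then show ?thesis
    using assms unity_root_pow_eq_1_iff[OF assms, of k] geometric_sum[of "unity_root_pow q k" q]
    by (auto simp: pow)
qed

text \<open>Expanding the square and summing over \<open>a\<close> and \<open>b\<close> first,
  orthogonality kills every pair \<open>(j, k)\<close> on which \<open>A\<close> or \<open>B\<close>
  disagrees modulo \<open>q\<close>. Each surviving pair contributes at most
  \<open>q ^ 2\<close>.\<close>

lemma exponential_sum_second_moment_le:
  fixes w :: "'a \<Rightarrow> complex" and A B :: "'a \<Rightarrow> int"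
  assumes q: "q > 0" and J: "finite J" and w: "\<And>j. j \<in> J \<Longrightarrow> norm (w j) \<le> 1"
  shows "(\<Sum>(a, b)\<in>{..<q} \<times> {..<q}. norm (\<Sum>j\<in>J. w j * unity_root_pow q (int a * A j + int b * B j)) ^ 2)
    \<le> real q ^ 2 * card {(j, k). j \<in> J \<and> k \<in> J \<and> [A j = A k] (mod int q) \<and> [B j = B k] (mod int q)}"
    (is "?lhs \<le> _ * real (card ?N)")
proof -
  let ?e = "unity_root_pow q"
  have sq: "of_real (norm (\<Sum>j\<in>J. w j * ?e (int a * A j + int b * B j)) ^ 2)
      = (\<Sum>(j, k)\<in>J \<times> J. w j * cnj (w k) * (?e (int a * (A j - A k)) * ?e (int b * (B j - B k))))" for a b
  proof -
    have "of_real (norm (\<Sum>j\<in>J. w j * ?e (int a * A j + int b * B j)) ^ 2)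
      = (\<Sum>j\<in>J. w j * ?e (int a * A j + int b * B j)) * cnj (\<Sum>j\<in>J. w j * ?e (int a * A j + int b * B j))"
      by (rule complex_norm_square)
    also have "\<dots> = (\<Sum>(j, k)\<in>J \<times> J. (w j * ?e (int a * A j + int b * B j)) * cnj (w k * ?e (int a * A k + int b * B k)))"
      by (simp add: sum_product sum.cartesian_product)
    also have "\<dots> = (\<Sum>(j, k)\<in>J \<times> J. w j * cnj (w k) * (?e (int a * (A j - A k)) * ?e (int b * (B j - B k))))"
    proof (intro sum.cong refl, clarify)
      fix j k
      have "?e (int a * A j + int b * B j) * cnj (?e (int a * A k + int b * B k))
          = ?e (int a * (A j - A k)) * ?e (int b * (B j - B k))"
        by (simp add: algebra_simps flip: unity_root_pow_add unity_root_pow_uminus)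
      then show "(w j * ?e (int a * A j + int b * B j)) * cnj (w k * ?e (int a * A k + int b * B k))
          = w j * cnj (w k) * (?e (int a * (A j - A k)) * ?e (int b * (B j - B k)))"
        by (simp add: mult_ac)
    qed
    finally show ?thesis .
  qed
  have "of_real ?lhs = (\<Sum>(a, b)\<in>{..<q} \<times> {..<q}. \<Sum>(j, k)\<in>J \<times> J.
      w j * cnj (w k) * (?e (int a * (A j - A k)) * ?e (int b * (B j - B k))))"
    unfolding of_real_sum by (intro sum.cong refl) (auto simp: sq simp del: of_real_power)
  also have "\<dots> = (\<Sum>(j, k)\<in>J \<times> J. \<Sum>(a, b)\<in>{..<q} \<times> {..<q}.
      w j * cnj (w k) * (?e (int a * (A j - A k)) * ?e (int b * (B j - B k))))"
    unfolding case_prod_beta by (rule sum.swap)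
  also have "\<dots> = (\<Sum>(j, k)\<in>J \<times> J. w j * cnj (w k) *
      ((\<Sum>a<q. ?e (int a * (A j - A k))) * (\<Sum>b<q. ?e (int b * (B j - B k)))))"
    by (intro sum.cong refl, clarify, simp only: sum_product sum.cartesian_product)
       (simp add: sum_distrib_left case_prod_beta)
  also have "\<dots> = (\<Sum>(j, k)\<in>J \<times> J. if (j, k) \<in> ?N then w j * cnj (w k) * of_nat q ^ 2 else 0)"
    by (intro sum.cong refl, clarify)
       (simp add: sum_unity_root_pow[OF q] cong_iff_dvd_diff power2_eq_square)
  also have "\<dots> = (\<Sum>(j, k)\<in>?N. w j * cnj (w k) * of_nat q ^ 2)"
    using J by (intro sum.mono_neutral_cong_right) (auto split: if_splits)
  finally have eq: "complex_of_real ?lhs = (\<Sum>(j, k)\<in>?N. w j * cnj (w k) * of_nat q ^ 2)" .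
  \<comment> \<open>The expansion is an identity between complex numbers; as the left side is a
    nonnegative real, it equals its norm and the triangle inequality applies.\<close>
  have "0 \<le> ?lhs" by (intro sum_nonneg) auto
  then have "?lhs = norm (complex_of_real ?lhs)"
    by (simp only: norm_of_real abs_of_nonneg)
  also have "\<dots> \<le> of_nat (card ?N) * real q ^ 2"
    unfolding eq
  proof (rule sum_norm_bound, clarify)
    fix j k assume "j \<in> J" "k \<in> J"
    then have "norm (w j) * norm (w k) \<le> 1 * 1" using w by (intro mult_mono) auto
    then show "norm (w j * cnj (w k) * of_nat q ^ 2) \<le> real q ^ 2"
      by (simp add: norm_mult norm_power mult_left_le_one_le)
  qed
  finally show ?thesis by (simp add: mult.commute)
qed

section \<open>Kloosterman sums twisted by a character, and their fourth moment\<close>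

definition unit_char :: "nat \<Rightarrow> (nat \<Rightarrow> complex) \<Rightarrow> bool" where
  "unit_char q \<psi> \<longleftrightarrow> (\<forall>p\<in>units_mod q. norm (\<psi> p) = 1) \<and>
     (\<forall>p\<in>units_mod q. \<forall>u\<in>units_mod q. \<psi> (p * u mod q) = \<psi> p * \<psi> u)"

definition kloosterman :: "(nat \<Rightarrow> complex) \<Rightarrow> nat \<Rightarrow> int \<Rightarrow> int \<Rightarrow> complex" where
  "kloosterman \<psi> q a b = (\<Sum>p\<in>units_mod q. \<psi> p * unity_root_pow q (a * int p + b * int (inv_mod q p)))"

lemma kloosterman_cong:
  assumes "[a = a'] (mod int q)" "[b = b'] (mod int q)"
  shows "kloosterman \<psi> q a b = kloosterman \<psi> q a' b'"
  unfolding kloosterman_def using assms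
  by (intro sum.cong refl arg_cong2[of _ _ _ _ "(*)"] unity_root_pow_cong cong_add cong_mult cong_refl)

text \<open>The substitution of \<open>p * u\<close> for \<open>p\<close> permutes the units, and
  multiplicativity pulls out \<open>\<psi> u\<close>, which has norm 1.\<close>

lemma norm_kloosterman_scale:
  assumes q: "q \<ge> 2" and \<psi>: "unit_char q \<psi>" and u: "u \<in> units_mod q"
  shows "norm (kloosterman \<psi> q (a * int u) (b * int (inv_mod q u))) = norm (kloosterman \<psi> q a b)"
proof -
  have "kloosterman \<psi> q a b = (\<Sum>p\<in>units_mod q. \<psi> (p * u mod q) *
      unity_root_pow q (a * int (p * u mod q) + b * int (inv_mod q (p * u mod q))))"
    unfolding kloosterman_def by (rule sum.reindex_bij_betw[OF bij_betw_mult_units_mod[OF q u], symmetric])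
  also have "\<dots> = (\<Sum>p\<in>units_mod q. \<psi> u * (\<psi> p *
      unity_root_pow q ((a * int u) * int p + (b * int (inv_mod q u)) * int (inv_mod q p))))"
  proof (intro sum.cong refl)
    fix p assume p: "p \<in> units_mod q"
    have "[int (p * u mod q) = int u * int p] (mod int q)"
      by (simp add: cong_def zmod_int mult.commute)
    moreover have "[int (inv_mod q (p * u mod q)) = int (inv_mod q u) * int (inv_mod q p)] (mod int q)"
      using inv_mod_mult[OF q p u] by (simp add: mult.commute flip: of_nat_mult cong_int_iff)
    ultimately have "[a * int (p * u mod q) + b * int (inv_mod q (p * u mod q))
        = a * (int u * int p) + b * (int (inv_mod q u) * int (inv_mod q p))] (mod int q)"
      by (intro cong_add cong_mult cong_refl)
    then have "unity_root_pow q (a * int (p * u mod q) + b * int (inv_mod q (p * u mod q)))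
        = unity_root_pow q ((a * int u) * int p + (b * int (inv_mod q u)) * int (inv_mod q p))"
      unfolding mult.assoc by (rule unity_root_pow_cong)
    then show "\<psi> (p * u mod q) * unity_root_pow q (a * int (p * u mod q) + b * int (inv_mod q (p * u mod q)))
        = \<psi> u * (\<psi> p * unity_root_pow q ((a * int u) * int p + (b * int (inv_mod q u)) * int (inv_mod q p)))"
      using \<psi> p u by (simp add: unit_char_def)
  qed
  also have "\<dots> = \<psi> u * kloosterman \<psi> q (a * int u) (b * int (inv_mod q u))"
    by (simp add: kloosterman_def sum_distrib_left)
  finally show ?thesis using \<psi> u by (simp add: unit_char_def norm_mult)
qed

text \<open>The first congruence determines the fourth entry from the other three. Clearing
  denominators in the second gives \<open>(p1 + p2) * p3 * p4 = (p3 + p4) * p1 * p2\<close> modulo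
  \<open>q\<close>; inserting \<open>p4 = p1 + p2 - p3\<close> turns this into the vanishing of
  \<open>(p1 - p3) * (p2 - p3) * (p1 + p2)\<close>.\<close>

lemma card_inverse_sum_quadruples_le:
  assumes q: "q > 0"
  shows "card {(j, k). j \<in> units_mod q \<times> units_mod q \<and> k \<in> units_mod q \<times> units_mod q \<and>
      [int (fst j) + int (snd j) = int (fst k) + int (snd k)] (mod int q) \<and>
      [int (inv_mod q (fst j)) + int (inv_mod q (snd j))
        = int (inv_mod q (fst k)) + int (inv_mod q (snd k))] (mod int q)}
    \<le> 2 * card {d. d dvd q} ^ 2 * q ^ 2" (is "card ?N \<le> _")
proof -
  let ?T = "{(p1, p2, p3). p1 \<in> {1..q} \<and> p2 \<in> {1..q} \<and> p3 \<in> {1..q} \<and>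
      int q dvd (int p1 - int p3) * (int p2 - int p3) * (int p1 + int p2)}"
  let ?f = "\<lambda>(j, k). (fst j, snd j, fst k) :: nat \<times> nat \<times> nat"
  have "inj_on ?f ?N"
  proof (rule inj_onI)
    fix x y assume x: "x \<in> ?N" and y: "y \<in> ?N" and eq: "?f x = ?f y"
    obtain p1 p2 p3 p4 where x': "x = ((p1, p2), (p3, p4))" by (metis prod.collapse)
    obtain r where y': "y = ((p1, p2), (p3, r))"
      using eq x' by (cases y) auto
    have "[int p1 + int p2 = int p3 + int p4] (mod int q)" "[int p1 + int p2 = int p3 + int r] (mod int q)"
      using x y unfolding x' y' by auto
    then have "[int p3 + int p4 = int p3 + int r] (mod int q)"
      by (rule cong_trans[OF cong_sym])
    then have "[p4 = r] (mod q)" by (simp add: cong_add_lcancel cong_int_iff)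
    moreover have "p4 \<in> units_mod q" "r \<in> units_mod q" using x y unfolding x' y' by auto
    ultimately show "x = y" unfolding x' y' using units_mod_cong_eq by blast
  qed
  moreover have "?f ` ?N \<subseteq> ?T"
  proof (rule image_subsetI)
    fix x assume x: "x \<in> ?N"
    obtain p1 p2 p3 p4 where x': "x = ((p1, p2), (p3, p4))" by (metis prod.collapse)
    have p: "p1 \<in> units_mod q" "p2 \<in> units_mod q" "p3 \<in> units_mod q" "p4 \<in> units_mod q"
      using x unfolding x' by auto
    define P1 P2 P3 P4 where "P1 = int p1" "P2 = int p2" "P3 = int p3" "P4 = int p4"
    define I1 I2 I3 I4 where "I1 = int (inv_mod q p1)" "I2 = int (inv_mod q p2)"
      "I3 = int (inv_mod q p3)" "I4 = int (inv_mod q p4)"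
    note defs = P1_P2_P3_P4_def I1_I2_I3_I4_def
    have inv: "int q dvd int r * int (inv_mod q r) - 1" if "r \<in> units_mod q" for r
    proof -
      have "[int (r * inv_mod q r) = int 1] (mod int q)"
        using cong_mult_inv_mod[OF that] by (simp only: cong_int_iff)
      then show ?thesis by (simp add: cong_iff_dvd_diff)
    qed
    have i1: "int q dvd P1 * I1 - 1" and i2: "int q dvd P2 * I2 - 1"
      and i3: "int q dvd P3 * I3 - 1" and i4: "int q dvd P4 * I4 - 1"
      unfolding defs using p[THEN inv] by blast+
    have dP: "int q dvd (P1 + P2) - (P3 + P4)" and dI: "int q dvd (I1 + I2) - (I3 + I4)"
      using x unfolding x' defs by (auto simp: cong_iff_dvd_diff)
    \<comment> \<open>An exact integer equation for \<open>P4\<close>, with the multiple of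
      \<open>q\<close> explicit, makes the factorisation below a polynomial identity.\<close>
    from dP obtain s where "(P1 + P2) - (P3 + P4) = int q * s" by (rule dvdE)
    then have P4: "P4 = P1 + P2 - P3 - int q * s" by simp
    \<comment> \<open>The congruence between inverses is multiplied by all four units; the remaining
      terms correct for replacing each \<open>P * I\<close> by 1.\<close>
    have "(P1 + P2) * P3 * P4 - (P3 + P4) * P1 * P2
        = P1 * P2 * P3 * P4 * ((I1 + I2) - (I3 + I4))
          - (P1 * I1 - 1) * P2 * P3 * P4 - (P2 * I2 - 1) * P1 * P3 * P4
          + (P3 * I3 - 1) * P1 * P2 * P4 + (P4 * I4 - 1) * P1 * P2 * P3"
      by (simp add: algebra_simps)
    also have "int q dvd \<dots>"
      by (rule dvd_add[OF dvd_add[OF dvd_diff[OF dvd_diff[OF dvd_mult[OF dI]]]]];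
          intro dvd_mult2 i1 i2 i3 i4)
    finally have "int q dvd (P1 + P2) * P3 * P4 - (P3 + P4) * P1 * P2" .
    moreover have "(P1 - P3) * (P2 - P3) * (P1 + P2)
        = - ((P1 + P2) * P3 * P4 - (P3 + P4) * P1 * P2) + int q * (P1 * P2 * s - (P1 + P2) * P3 * s)"
      unfolding P4 by (simp add: algebra_simps)
    ultimately have "int q dvd (P1 - P3) * (P2 - P3) * (P1 + P2)"
      using dvd_add[OF iffD2[OF dvd_minus_iff] dvd_triv_left] by metis
    then show "?f x \<in> ?T"
      using p unfolding x' defs by (auto simp: units_mod_def)
  qed
  moreover have "finite ?T"
    by (rule finite_subset[of _ "{1..q} \<times> {1..q} \<times> {1..q}"]) auto
  ultimately have "card ?N \<le> card ?T" by (rule card_inj_on_le)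
  also have "\<dots> \<le> 2 * card {d. d dvd q} ^ 2 * q ^ 2" by (rule card_triples_le[OF q])
  finally show ?thesis .
qed

text \<open>The square of a Kloosterman sum is an exponential sum over pairs of units, so its fourth
  moment is a second moment governed by the count of quadruples.\<close>

lemma kloosterman_fourth_moment_le:
  assumes q: "q > 0" and \<psi>: "unit_char q \<psi>"
  shows "(\<Sum>(a, b)\<in>{..<q} \<times> {..<q}. norm (kloosterman \<psi> q (int a) (int b)) ^ 4)
    \<le> 2 * real (card {d. d dvd q}) ^ 2 * real q ^ 4"
proof -
  let ?U = "units_mod q"
  define w where "w j = \<psi> (fst j) * \<psi> (snd j)" for j
  define A where "A j = int (fst j) + int (snd j)" for j :: "nat \<times> nat"
  define B where "B j = int (inv_mod q (fst j)) + int (inv_mod q (snd j))" for j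
  have sq: "kloosterman \<psi> q a b ^ 2 = (\<Sum>j\<in>?U \<times> ?U. w j * unity_root_pow q (a * A j + b * B j))" for a b
  proof -
    have "kloosterman \<psi> q a b ^ 2 = (\<Sum>(p, p')\<in>?U \<times> ?U.
      (\<psi> p * unity_root_pow q (a * int p + b * int (inv_mod q p))) *
      (\<psi> p' * unity_root_pow q (a * int p' + b * int (inv_mod q p'))))"
      by (simp add: kloosterman_def power2_eq_square sum_product sum.cartesian_product)
    also have "\<dots> = (\<Sum>j\<in>?U \<times> ?U. w j * unity_root_pow q (a * A j + b * B j))"
    proof (intro sum.cong refl, clarify)
      fix p p'
      have "unity_root_pow q (a * A (p, p') + b * B (p, p'))
        = unity_root_pow q (a * int p + b * int (inv_mod q p)) * unity_root_pow q (a * int p' + b * int (inv_mod q p'))"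
        by (simp add: A_def B_def algebra_simps flip: unity_root_pow_add)
      then show "(\<psi> p * unity_root_pow q (a * int p + b * int (inv_mod q p))) *
          (\<psi> p' * unity_root_pow q (a * int p' + b * int (inv_mod q p')))
          = w (p, p') * unity_root_pow q (a * A (p, p') + b * B (p, p'))"
        by (simp add: w_def)
    qed
    finally show ?thesis .
  qed
  have "norm (kloosterman \<psi> q a b) ^ 4
      = norm (\<Sum>j\<in>?U \<times> ?U. w j * unity_root_pow q (a * A j + b * B j)) ^ 2" for a b
    by (simp add: norm_power flip: sq power_mult)
  then have "(\<Sum>(a, b)\<in>{..<q} \<times> {..<q}. norm (kloosterman \<psi> q (int a) (int b)) ^ 4)
    = (\<Sum>(a, b)\<in>{..<q} \<times> {..<q}. norm (\<Sum>j\<in>?U \<times> ?U. w j * unity_root_pow q (int a * A j + int b * B j)) ^ 2)"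
    by simp
  also have "\<dots> \<le> real q ^ 2 * card {(j, k). j \<in> ?U \<times> ?U \<and> k \<in> ?U \<times> ?U
      \<and> [A j = A k] (mod int q) \<and> [B j = B k] (mod int q)}"
    by (rule exponential_sum_second_moment_le[OF q])
       (use \<psi> in \<open>auto simp: w_def norm_mult unit_char_def\<close>)
  also have "\<dots> \<le> real q ^ 2 * real (2 * card {d. d dvd q} ^ 2 * q ^ 2)"
    unfolding A_def B_def
    by (intro mult_left_mono of_nat_mono card_inverse_sum_quadruples_le q) simp
  also have "\<dots> = 2 * real (card {d. d dvd q}) ^ 2 * real q ^ 4"
    by (simp add: power_numeral_reduce)
  finally show ?thesis .
qed

text \<open>Multiplication by the absolute value of \<open>m\<close> sends the solutions injectively
  into one residue class modulo \<open>q\<close> within \<open>{1..q * nat \<bar>m\<bar>}\<close>.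
  The factor \<open>sgn m\<close> accounts for negative \<open>m\<close>.\<close>

lemma card_linear_congruence_le:
  fixes m :: int
  assumes q: "q > 0" and m: "m \<noteq> 0" and g: "inj_on g U" "g ` U \<subseteq> {1..q}"
  shows "card {u \<in> U. [m * int (g u) = c] (mod int q)} \<le> nat \<bar>m\<bar>"
proof -
  let ?W = "{w \<in> {1..q * nat \<bar>m\<bar>}. [int w = sgn m * c] (mod int q)}"
  have "inj_on (\<lambda>u. nat \<bar>m\<bar> * g u) U"
    using g(1) m by (auto simp: inj_on_def)
  then have "inj_on (\<lambda>u. nat \<bar>m\<bar> * g u) {u \<in> U. [m * int (g u) = c] (mod int q)}"
    by (rule inj_on_subset) auto
  moreover have "(\<lambda>u. nat \<bar>m\<bar> * g u) ` {u \<in> U. [m * int (g u) = c] (mod int q)} \<subseteq> ?W"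
  proof (rule image_subsetI)
    fix u assume u: "u \<in> {u \<in> U. [m * int (g u) = c] (mod int q)}"
    then have "g u \<in> {1..q}" using g(2) by auto
    then have "nat \<bar>m\<bar> * g u \<in> {1..q * nat \<bar>m\<bar>}"
      using m by (auto simp: mult.commute[of q] Suc_le_eq)
    moreover have "[sgn m * (m * int (g u)) = sgn m * c] (mod int q)"
      using u by (intro cong_mult cong_refl) auto
    moreover have "sgn m * (m * int (g u)) = int (nat \<bar>m\<bar> * g u)"
      by (auto simp: sgn_if)
    ultimately show "nat \<bar>m\<bar> * g u \<in> ?W" by auto
  qed
  ultimately have "card {u \<in> U. [m * int (g u) = c] (mod int q)} \<le> card ?W"
    by (rule card_inj_on_le) simp
  also have "\<dots> \<le> nat \<bar>m\<bar>" by (rule card_cong_interval_le[OF q])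
  finally show ?thesis .
qed

lemma sum_le_fibre_card:
  fixes G :: "'b \<Rightarrow> real"
  assumes "finite A" "finite B" "h ` A \<subseteq> B" "\<And>y. y \<in> B \<Longrightarrow> G y \<ge> 0"
    "\<And>y. y \<in> B \<Longrightarrow> card {x \<in> A. h x = y} \<le> M"
  shows "(\<Sum>x\<in>A. G (h x)) \<le> real M * (\<Sum>y\<in>B. G y)"
proof -
  have "(\<Sum>x\<in>A. G (h x)) = (\<Sum>y\<in>B. \<Sum>x\<in>{x \<in> A. h x = y}. G (h x))"
    using assms by (intro sum.group[symmetric])
  also have "\<dots> = (\<Sum>y\<in>B. real (card {x \<in> A. h x = y}) * G y)"
    by (intro sum.cong refl) simp
  also have "\<dots> \<le> (\<Sum>y\<in>B. real M * G y)"
    using assms by (intro sum_mono mult_right_mono) auto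
  finally show ?thesis by (simp add: sum_distrib_left)
qed

text \<open>All \<open>totient q\<close> pairs in the orbit of \<open>(m, n * t)\<close> give sums
  of the same norm, and after reduction modulo \<open>q\<close> no pair is hit more than
  \<open>\<bar>m\<bar> + \<bar>n\<bar>\<close> times. Hence the fourth moment dominates. The bound
  does not involve \<open>t\<close>, whence the uniformity of the final result.\<close>

lemma kloosterman_bound:
  assumes q: "q \<ge> 2" and \<psi>: "unit_char q \<psi>" and t: "t \<in> units_mod q" and mn: "m \<noteq> 0 \<or> n \<noteq> 0"
  shows "real (totient q) * norm (kloosterman \<psi> q m (n * int t)) ^ 4
    \<le> real (nat (\<bar>m\<bar> + \<bar>n\<bar>)) * (2 * real (card {d. d dvd q}) ^ 2 * real q ^ 4)"
proof -
  let ?U = "units_mod q" and ?R = "{..<q} \<times> {..<q}"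
  have q0: "q > 0" using q by simp
  \<comment> \<open>Absorbing \<open>t\<close> into the inverse leaves the fixed coefficient
    \<open>n\<close> in the second coordinate, so the fibres are bounded independently of
    \<open>t\<close>.\<close>
  define g where "g u = t * inv_mod q u mod q" for u
  have U_sub: "?U \<subseteq> {1..q}" by (auto simp: units_mod_def)
  have g_in: "g u \<in> ?U" if "u \<in> ?U" for u
    unfolding g_def using q t inv_mod_in_units_mod[OF that]
    by (auto intro!: mod_in_units_mod simp: coprime_units_mod)
  have "inj_on (\<lambda>p. p * t mod q) ?U"
    using bij_betw_mult_units_mod[OF q t] by (simp add: bij_betw_def)
  then have "inj_on (\<lambda>u. inv_mod q u * t mod q) ?U"
    using inj_on_inv_mod[of q] inv_mod_in_units_mod by (auto simp: inj_on_def)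
  then have inj_g: "inj_on g ?U" unfolding g_def by (simp add: mult.commute)
  define h where "h u = (nat ((m * int u) mod int q), nat ((n * int (g u)) mod int q))" for u
  define G where "G = (\<lambda>(a, b). norm (kloosterman \<psi> q (int a) (int b)) ^ 4)"
  have Gh: "G (h u) = norm (kloosterman \<psi> q m (n * int t)) ^ 4" if u: "u \<in> ?U" for u
  proof -
    have "[n * int (g u) = n * int t * int (inv_mod q u)] (mod int q)"
      by (simp add: g_def cong_def zmod_int mod_simps mult.assoc)
    then have "kloosterman \<psi> q (m * int u mod int q) (n * int (g u) mod int q)
        = kloosterman \<psi> q (m * int u) (n * int t * int (inv_mod q u))"
      by (intro kloosterman_cong) (auto simp: cong_def)
    then show ?thesis
      using norm_kloosterman_scale[OF q \<psi> u, of m "n * int t"] q0 by (simp add: G_def h_def)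
  qed
  \<comment> \<open>One coordinate with nonzero coefficient suffices: the first if
    \<open>m \<noteq> 0\<close>, otherwise the second.\<close>
  have fibre: "card {u \<in> ?U. h u = y} \<le> nat (\<bar>m\<bar> + \<bar>n\<bar>)" for y
  proof (cases "m = 0")
    case False
    have "{u \<in> ?U. h u = y} \<subseteq> {u \<in> ?U. [m * int (id u) = int (fst y)] (mod int q)}"
      using q0 by (auto simp: h_def cong_def)
    then have "card {u \<in> ?U. h u = y} \<le> card {u \<in> ?U. [m * int (id u) = int (fst y)] (mod int q)}"
      by (intro card_mono) auto
    also have "\<dots> \<le> nat \<bar>m\<bar>"
      using U_sub by (intro card_linear_congruence_le q0 False) auto
    finally show ?thesis by simp
  next
    case True
    have "{u \<in> ?U. h u = y} \<subseteq> {u \<in> ?U. [n * int (g u) = int (snd y)] (mod int q)}"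
      using q0 by (auto simp: h_def cong_def)
    then have "card {u \<in> ?U. h u = y} \<le> card {u \<in> ?U. [n * int (g u) = int (snd y)] (mod int q)}"
      by (intro card_mono) auto
    also have "\<dots> \<le> nat \<bar>n\<bar>"
      using U_sub g_in mn True by (intro card_linear_congruence_le q0 inj_g) auto
    finally show ?thesis by simp
  qed
  have "real (totient q) * norm (kloosterman \<psi> q m (n * int t)) ^ 4 = (\<Sum>u\<in>?U. G (h u))"
    by (simp add: Gh card_units_mod)
  also have "\<dots> \<le> real (nat (\<bar>m\<bar> + \<bar>n\<bar>)) * (\<Sum>y\<in>?R. G y)"
  proof (rule sum_le_fibre_card[OF _ _ _ _ fibre])
    show "h ` ?U \<subseteq> ?R" using q0 by (auto simp: h_def nat_less_iff)
  qed (auto simp: G_def)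
  also have "\<dots> \<le> real (nat (\<bar>m\<bar> + \<bar>n\<bar>)) * (2 * real (card {d. d dvd q}) ^ 2 * real q ^ 4)"
    using kloosterman_fourth_moment_le[OF q0 \<psi>] by (intro mult_left_mono) (simp_all add: G_def)
  finally show ?thesis .
qed

section \<open>Equidistribution with characters\<close>

text \<open>For the normalised sum \<open>X\<close>, the moment bound and
  \<open>q \<le> d * \<phi>\<close> give \<open>q * X ^ 4 \<le> 2 * M * d ^ 7\<close>. The eighth
  power of this and \<open>d ^ 8 \<le> C * q\<close> yield \<open>q * X ^ 32 \<le> D\<close>, a
  decay of order \<open>q\<close> to the power -1/32, with constants depending only on
  \<open>m\<close> and \<open>n\<close>.\<close>

lemma kloosterman_decay:
  assumes mn: "m \<noteq> 0 \<or> n \<noteq> 0" and e: "e > 0"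
  shows "\<exists>Q. \<forall>q\<ge>Q. \<forall>\<psi>. unit_char q \<psi> \<longrightarrow> (\<forall>t\<in>units_mod q.
      norm (kloosterman \<psi> q m (n * int t)) / real (totient q) < e)"
proof -
  obtain C :: nat where C: "\<And>n. n > 0 \<Longrightarrow> card {d. d dvd n} ^ 8 \<le> C * n"
    by (rule divisor_count_bound[of 8]) auto
  define M where "M = real (nat (\<bar>m\<bar> + \<bar>n\<bar>))"
  define D where "D = (2 * M) ^ 8 * real C ^ 7"
  \<comment> \<open>Beyond this threshold \<open>X \<ge> e\<close> would contradict
    \<open>q * X ^ 32 \<le> D\<close>.\<close>
  obtain Q :: nat where Q: "D / e ^ 32 < real Q" using reals_Archimedean2 by blast
  show ?thesis
  proof (intro exI[of _ "max 2 Q"] allI impI ballI)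
    fix q \<psi> t assume "max 2 Q \<le> q" and \<psi>: "unit_char q \<psi>" and t: "t \<in> units_mod q"
    then have q: "q \<ge> 2" "Q \<le> q" by auto
    define d where "d = real (card {d. d dvd q})"
    define \<phi> where "\<phi> = real (totient q)"
    define S where "S = norm (kloosterman \<psi> q m (n * int t))"
    define X where "X = S / \<phi>"
    have \<phi>: "\<phi> > 0" using q by (simp add: \<phi>_def)
    have X: "X \<ge> 0" "S = X * \<phi>" using \<phi> by (auto simp: X_def S_def)
    have "M \<ge> 0" "d \<ge> 0" by (auto simp: M_def d_def)
    have q\<phi>: "real q \<le> d * \<phi>"
      using le_divisor_count_mult_totient[of q] q by (simp add: d_def \<phi>_def flip: of_nat_mult)
    \<comment> \<open>The extra \<open>q ^ 4\<close> is there to cancel the one in the moment bound.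
      Of the five factors \<open>d * \<phi>\<close>, four turn \<open>X ^ 4\<close> into
      \<open>S ^ 4\<close> and the fifth supplies the \<open>\<phi>\<close> of
      \<open>kloosterman_bound\<close>.\<close>
    have "real q ^ 4 * (real q * X ^ 4) = real q ^ 5 * X ^ 4"
      by (simp add: power_numeral_reduce)
    also have "\<dots> \<le> (d * \<phi>) ^ 5 * X ^ 4"
      by (intro mult_right_mono power_mono q\<phi>) (use X in auto)
    also have "\<dots> = d ^ 5 * (\<phi> * S ^ 4)"
      unfolding X(2) by (simp add: power_numeral_reduce)
    also have "\<dots> \<le> d ^ 5 * (M * (2 * d ^ 2 * real q ^ 4))"
      using kloosterman_bound[OF q(1) \<psi> t mn] \<open>d \<ge> 0\<close>
      by (intro mult_left_mono) (simp_all add: \<phi>_def S_def M_def d_def)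
    also have "\<dots> = real q ^ 4 * (2 * M * d ^ 7)" by (simp add: power_numeral_reduce)
    finally have "real q * X ^ 4 \<le> 2 * M * d ^ 7"
      using q by (subst (asm) mult_le_cancel_left_pos) auto
    from power_mono[OF this] have "(real q * X ^ 4) ^ 8 \<le> (2 * M * d ^ 7) ^ 8"
      using X by simp
    also have "(2 * M * d ^ 7) ^ 8 = (2 * M) ^ 8 * (d ^ 8) ^ 7"
      by (simp add: power_mult_distrib flip: power_mult)
    also have "(real q * X ^ 4) ^ 8 = real q ^ 7 * (real q * X ^ 32)"
      using power_add[of "real q" 7 1] by (simp add: power_mult_distrib flip: power_mult)
    also have "(2 * M) ^ 8 * (d ^ 8) ^ 7 \<le> (2 * M) ^ 8 * (real C * real q) ^ 7"
    proof -
      have "d ^ 8 \<le> real C * real q"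
        using C[of q] q unfolding d_def by (simp flip: of_nat_power of_nat_mult)
      then show ?thesis using \<open>d \<ge> 0\<close> \<open>M \<ge> 0\<close> by (intro mult_left_mono power_mono) auto
    qed
    also have "(2 * M) ^ 8 * (real C * real q) ^ 7 = real q ^ 7 * D" by (simp add: D_def power_mult_distrib)
    finally have le: "real q * X ^ 32 \<le> D"
      using q by (subst (asm) mult_le_cancel_left_pos) auto
    have "X < e"
    proof (rule ccontr)
      assume "\<not> X < e"
      then have "real q * e ^ 32 \<le> real q * X ^ 32"
        using e by (intro mult_left_mono power_mono) auto
      moreover have "D < real q * e ^ 32"
        using Q q(2) e by (simp add: divide_less_eq) (meson less_le_trans mult_right_mono of_nat_le_iff zero_le_power less_imp_le)
      ultimately show False using le by simp
    qed
    then show "norm (kloosterman \<psi> q m (n * int t)) / real (totient q) < e"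
      by (simp add: X_def S_def \<phi>_def)
  qed
qed

section \<open>Averages of test functions twisted by a character\<close>

definition twisted_avg :: "(real \<times> real \<Rightarrow> complex) \<Rightarrow> (nat \<Rightarrow> complex) \<Rightarrow> nat \<Rightarrow> nat \<Rightarrow> complex" where
  "twisted_avg f \<psi> q t = (1 / of_nat (totient q)) *
     (\<Sum>p\<in>units_mod q. \<psi> p * f (real p / real q, real (t * inv_mod q p) / real q))"

definition char_mean :: "(nat \<Rightarrow> complex) \<Rightarrow> nat \<Rightarrow> complex" where
  "char_mean \<psi> q = (1 / of_nat (totient q)) * (\<Sum>p\<in>units_mod q. \<psi> p)"

lemma norm_twisted_sum_le:
  assumes "unit_char q \<psi>" "\<And>p. p \<in> units_mod q \<Longrightarrow> norm (g p) \<le> B" "B \<ge> 0"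
  shows "norm ((1 / of_nat (totient q)) * (\<Sum>p\<in>units_mod q. \<psi> p * g p)) \<le> B"
proof (cases "q = 0")
  case False
  have "norm (\<Sum>p\<in>units_mod q. \<psi> p * g p) \<le> of_nat (card (units_mod q)) * B"
    by (rule sum_norm_bound) (use assms in \<open>auto simp: unit_char_def norm_mult\<close>)
  then show ?thesis using False by (simp add: norm_mult norm_divide card_units_mod divide_le_eq mult.commute)
qed (use assms in simp)

lemma norm_char_mean_le: "unit_char q \<psi> \<Longrightarrow> norm (char_mean \<psi> q) \<le> 1"
  using norm_twisted_sum_le[of q \<psi> "\<lambda>_. 1" 1] by (simp add: char_mean_def)

lemma char_mean_nontrivial:
  assumes q: "q \<ge> 2" and \<psi>: "unit_char q \<psi>" and u: "u \<in> units_mod q" "\<psi> u \<noteq> 1"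
  shows "char_mean \<psi> q = 0"
proof -
  have "(\<Sum>p\<in>units_mod q. \<psi> p) = (\<Sum>p\<in>units_mod q. \<psi> (p * u mod q))"
    by (rule sum.reindex_bij_betw[OF bij_betw_mult_units_mod[OF q u(1)], symmetric])
  also have "\<dots> = (\<Sum>p\<in>units_mod q. \<psi> p) * \<psi> u"
    using \<psi> u by (simp add: unit_char_def sum_distrib_right)
  finally have "(\<Sum>p\<in>units_mod q. \<psi> p) = 0" using u(2) by simp
  then show ?thesis by (simp add: char_mean_def)
qed

lemma twisted_avg_torus_char:
  "twisted_avg (torus_char m n) \<psi> q t = kloosterman \<psi> q m (n * int t) / of_nat (totient q)"
  by (simp add: twisted_avg_def kloosterman_def torus_char_def unity_root_pow_def
      add_divide_distrib mult.assoc)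

text \<open>The constant torus character gives equality and the others decay by the Kloosterman
  bound; linearity does the rest. The threshold precedes \<open>\<psi>\<close> and \<open>t\<close>,
  so the character may later vary with \<open>q\<close>.\<close>

lemma twisted_avg_tendsto_trig_poly:
  assumes "trig_poly f" "e > 0"
  shows "\<exists>Q. \<forall>q\<ge>Q. \<forall>\<psi>. unit_char q \<psi> \<longrightarrow> (\<forall>t\<in>units_mod q.
    norm (twisted_avg f \<psi> q t - char_mean \<psi> q * integral (cbox (0, 0) (1, 1)) f) < e)"
  using assms
proof (induction arbitrary: e)
  case (char m n)
  show ?case
  proof (cases "m = 0 \<and> n = 0")
    case True
    then have "twisted_avg (torus_char m n) \<psi> q t
        = char_mean \<psi> q * integral (cbox (0, 0) (1, 1)) (torus_char m n)" for \<psi> q t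
      by (simp add: integral_torus_char twisted_avg_def char_mean_def torus_char_def)
    then show ?thesis using char by simp
  next
    case False
    then show ?thesis
      using kloosterman_decay[OF _ char, of m n]
      by (auto simp: integral_torus_char twisted_avg_torus_char norm_divide)
  qed
next
  case (add f g)
  let ?I = "integral (cbox (0, 0) (1, 1))"
  obtain Q1 Q2 where Q: "\<And>q \<psi> t. q \<ge> Q1 \<Longrightarrow> unit_char q \<psi> \<Longrightarrow> t \<in> units_mod q \<Longrightarrow>
      norm (twisted_avg f \<psi> q t - char_mean \<psi> q * ?I f) < e / 2"
    "\<And>q \<psi> t. q \<ge> Q2 \<Longrightarrow> unit_char q \<psi> \<Longrightarrow> t \<in> units_mod q \<Longrightarrow>
      norm (twisted_avg g \<psi> q t - char_mean \<psi> q * ?I g) < e / 2"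
    using add.IH[of "e / 2"] \<open>e > 0\<close> by (metis half_gt_zero)
  have int: "?I (\<lambda>z. f z + g z) = ?I f + ?I g"
    using add.hyps by (intro Henstock_Kurzweil_Integration.integral_add integrable_continuous continuous_on_trig_poly)
  have avg: "twisted_avg (\<lambda>z. f z + g z) \<psi> q t = twisted_avg f \<psi> q t + twisted_avg g \<psi> q t" for \<psi> q t
    by (simp add: twisted_avg_def distrib_left sum.distrib)
  show ?case
  proof (intro exI[of _ "max Q1 Q2"] allI impI ballI)
    fix q \<psi> t assume "max Q1 Q2 \<le> q" "unit_char q \<psi>" "t \<in> units_mod q"
    then have "norm ((twisted_avg f \<psi> q t - char_mean \<psi> q * ?I f) + (twisted_avg g \<psi> q t - char_mean \<psi> q * ?I g)) < e / 2 + e / 2"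
      by (intro norm_add_less Q) auto
    then show "norm (twisted_avg (\<lambda>z. f z + g z) \<psi> q t - char_mean \<psi> q * ?I (\<lambda>z. f z + g z)) < e"
      by (simp add: int avg algebra_simps)
  qed
next
  case (scale f c)
  let ?I = "integral (cbox (0, 0) (1, 1))"
  have "e / (norm c + 1) > 0" using scale.prems by (simp add: add_nonneg_pos)
  from scale.IH[OF this] obtain Q where Q: "\<And>q \<psi> t. q \<ge> Q \<Longrightarrow> unit_char q \<psi> \<Longrightarrow> t \<in> units_mod q \<Longrightarrow>
      norm (twisted_avg f \<psi> q t - char_mean \<psi> q * ?I f) < e / (norm c + 1)"
    by blast
  have avg: "twisted_avg (\<lambda>z. c * f z) \<psi> q t = c * twisted_avg f \<psi> q t" for \<psi> q t
    by (simp add: twisted_avg_def sum_distrib_left mult_ac)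
  show ?case
  proof (intro exI[of _ Q] allI impI ballI)
    fix q \<psi> t assume *: "Q \<le> q" "unit_char q \<psi>" "t \<in> units_mod q"
    have "norm (twisted_avg (\<lambda>z. c * f z) \<psi> q t - char_mean \<psi> q * ?I (\<lambda>z. c * f z))
        = norm c * norm (twisted_avg f \<psi> q t - char_mean \<psi> q * ?I f)"
      by (simp add: avg algebra_simps flip: norm_mult)
    also have "\<dots> \<le> norm c * (e / (norm c + 1))"
      using Q[OF *] by (intro mult_left_mono) auto
    also have "\<dots> < e" using scale.prems by (simp add: divide_less_eq add_nonneg_pos)
    finally show "norm (twisted_avg (\<lambda>z. c * f z) \<psi> q t - char_mean \<psi> q * ?I (\<lambda>z. c * f z)) < e" .
  qed
qed

text \<open>Approximating \<open>f\<close> uniformly by a trigonometric polynomial changes both the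
  average and the main term by at most \<open>e / 4\<close>, because the character values and their
  mean have norm at most 1.\<close>

lemma twisted_avg_tendsto:
  assumes f: "torus_continuous f" and e: "e > 0"
  shows "\<exists>Q. \<forall>q\<ge>Q. \<forall>\<psi>. unit_char q \<psi> \<longrightarrow> (\<forall>t\<in>units_mod q.
    norm (twisted_avg f \<psi> q t - char_mean \<psi> q * integral (cbox (0, 0) (1, 1)) f) < e)"
proof -
  let ?B = "cbox (0 :: real, 0 :: real) (1, 1)"
  let ?I = "integral ?B"
  have e4: "e / 4 > 0" using e by simp
  obtain g where g: "trig_poly g" "\<And>z. norm (f z - g z) < e / 4"
    using trig_poly_dense[OF f e4] by metis
  obtain Q where Q: "\<And>q \<psi> t. q \<ge> Q \<Longrightarrow> unit_char q \<psi> \<Longrightarrow> t \<in> units_mod q \<Longrightarrow>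
      norm (twisted_avg g \<psi> q t - char_mean \<psi> q * ?I g) < e / 4"
    using twisted_avg_tendsto_trig_poly[OF g(1) e4] by blast
  have cont: "continuous_on ?B f" "continuous_on ?B g"
    using f continuous_on_trig_poly[OF g(1)] continuous_on_subset[OF _ subset_UNIV]
    by (auto simp: torus_continuous_def)
  have "((\<lambda>z. f z - g z) has_integral (?I f - ?I g)) ?B"
    by (intro has_integral_diff integrable_integral integrable_continuous cont)
  then have int: "norm (?I f - ?I g) \<le> e / 4 * measure lborel ?B"
    by (rule has_integral_bound[rotated]) (use g(2) e in \<open>auto intro: less_imp_le\<close>)
  have "measure lborel ?B = 1" by (simp add: content_Pair)
  with int have int: "norm (?I f - ?I g) \<le> e / 4" by simp
  show ?thesis
  proof (intro exI[of _ Q] allI impI ballI)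
    fix q \<psi> t assume *: "Q \<le> q" "unit_char q \<psi>" "t \<in> units_mod q"
    have "twisted_avg f \<psi> q t - twisted_avg g \<psi> q t = (1 / of_nat (totient q)) *
     (\<Sum>p\<in>units_mod q. \<psi> p * (f (real p / real q, real (t * inv_mod q p) / real q)
       - g (real p / real q, real (t * inv_mod q p) / real q)))"
      by (simp add: twisted_avg_def right_diff_distrib sum_subtractf)
    then have 1: "norm (twisted_avg f \<psi> q t - twisted_avg g \<psi> q t) \<le> e / 4"
      using norm_twisted_sum_le[OF *(2), of _ "e / 4"] g(2) e by (simp add: less_imp_le)
    have "norm (char_mean \<psi> q * (?I f - ?I g)) \<le> 1 * (e / 4)"
      unfolding norm_mult using norm_char_mean_le[OF *(2)] int by (intro mult_mono) auto
    then have 2: "norm (char_mean \<psi> q * (?I f - ?I g)) \<le> e / 4" by simp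
    have eq: "twisted_avg f \<psi> q t - char_mean \<psi> q * ?I f
        = (twisted_avg f \<psi> q t - twisted_avg g \<psi> q t) + (twisted_avg g \<psi> q t - char_mean \<psi> q * ?I g)
          - char_mean \<psi> q * (?I f - ?I g)"
      by (simp add: algebra_simps)
    have "norm (twisted_avg f \<psi> q t - char_mean \<psi> q * ?I f) \<le> norm (twisted_avg f \<psi> q t - twisted_avg g \<psi> q t)
        + norm (twisted_avg g \<psi> q t - char_mean \<psi> q * ?I g) + norm (char_mean \<psi> q * (?I f - ?I g))"
      unfolding eq by (rule order_trans[OF norm_triangle_ineq4 add_right_mono[OF norm_triangle_ineq]])
    then show "norm (twisted_avg f \<psi> q t - char_mean \<psi> q * ?I f) < e"
      using 1 2 Q[OF *] e by linarith
  qed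
qed

text \<open>If the indicator of \<open>P\<close> is the mean of \<open>k\<close> terms
  \<open>c i * \<psi> i\<close>, the term for \<open>i = 0\<close> is identically 1 and produces the
  limit, while nontrivial characters have mean 0. Unit coefficients keep the error below
  \<open>e\<close>.\<close>

lemma kl_avg_tendsto_char_combination:
  assumes f: "torus_continuous f" and e: "e > 0"
  obtains Q where "\<And>q P c \<psi> k t. q \<ge> Q \<Longrightarrow> k > 0 \<Longrightarrow>
    (\<And>i. i < k \<Longrightarrow> unit_char q (\<psi> i)) \<Longrightarrow> (\<And>i. i < k \<Longrightarrow> norm (c i) = 1) \<Longrightarrow>
    (\<And>p. p \<in> units_mod q \<Longrightarrow> c 0 * \<psi> 0 p = 1) \<Longrightarrow>
    (\<And>i. 0 < i \<Longrightarrow> i < k \<Longrightarrow> \<exists>u\<in>units_mod q. \<psi> i u \<noteq> 1) \<Longrightarrow>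
    (\<And>p. p \<in> units_mod q \<Longrightarrow> of_bool (P p) = (\<Sum>i<k. c i * \<psi> i p) / of_nat k) \<Longrightarrow>
    t \<in> units_mod q \<Longrightarrow>
    norm (kl_avg f P q t - integral (cbox (0, 0) (1, 1)) f / of_nat k) < e"
proof -
  let ?I = "integral (cbox (0, 0) (1, 1)) f"
  obtain Q where Q: "\<And>q \<psi> t. q \<ge> Q \<Longrightarrow> unit_char q \<psi> \<Longrightarrow> t \<in> units_mod q \<Longrightarrow>
      norm (twisted_avg f \<psi> q t - char_mean \<psi> q * ?I) < e / 2"
    using twisted_avg_tendsto[OF f, of "e / 2"] e by (metis half_gt_zero)
  show thesis
  proof (rule that[of "max 2 Q"])
    fix q t k :: nat and P and c :: "nat \<Rightarrow> complex" and \<psi>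
    assume "max 2 Q \<le> q" and k: "0 < k" and \<psi>: "\<And>i. i < k \<Longrightarrow> unit_char q (\<psi> i)"
      and c: "\<And>i. i < k \<Longrightarrow> norm (c i) = 1"
      and c0: "\<And>p. p \<in> units_mod q \<Longrightarrow> c 0 * \<psi> 0 p = 1"
      and nontriv: "\<And>i. 0 < i \<Longrightarrow> i < k \<Longrightarrow> \<exists>u\<in>units_mod q. \<psi> i u \<noteq> 1"
      and ind: "\<And>p. p \<in> units_mod q \<Longrightarrow> of_bool (P p) = (\<Sum>i<k. c i * \<psi> i p) / of_nat k"
      and t: "t \<in> units_mod q"
    from \<open>max 2 Q \<le> q\<close> have q: "q \<ge> 2" "q \<ge> Q" by auto
    define F where "F p = f (real p / real q, real (t * inv_mod q p) / real q)" for p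
    have "kl_avg f P q t = (1 / of_nat (totient q)) * (\<Sum>p\<in>units_mod q. of_bool (P p) * F p)"
      unfolding kl_avg_def F_def[symmetric]
      by (intro arg_cong[of _ _ "\<lambda>x. _ * x"] sum.mono_neutral_cong_left) auto
    also have "(\<Sum>p\<in>units_mod q. of_bool (P p) * F p)
        = (\<Sum>p\<in>units_mod q. \<Sum>i<k. c i / of_nat k * (\<psi> i p * F p))"
      using ind by (intro sum.cong refl) (simp add: sum_distrib_right sum_divide_distrib mult.assoc)
    also have "\<dots> = (\<Sum>i<k. \<Sum>p\<in>units_mod q. c i / of_nat k * (\<psi> i p * F p))"
      by (rule sum.swap)
    finally have "kl_avg f P q t = (\<Sum>i<k. c i / of_nat k * twisted_avg f (\<psi> i) q t)"
      by (simp add: twisted_avg_def F_def sum_distrib_left mult_ac)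
    \<comment> \<open>The main term is put in the same form as the average, so that the two can be
      compared character by character.\<close>
    moreover have "?I / of_nat k = (\<Sum>i<k. c i / of_nat k * (char_mean (\<psi> i) q * ?I))"
    proof -
      have "c i * char_mean (\<psi> i) q = of_bool (i = 0)" if "i < k" for i
      proof (cases "i = 0")
        case True
        have "c 0 * char_mean (\<psi> 0) q = (1 / of_nat (totient q)) * (\<Sum>p\<in>units_mod q. c 0 * \<psi> 0 p)"
          unfolding char_mean_def sum_distrib_left[symmetric] by simp
        also have "\<dots> = 1" using c0 q by (simp add: card_units_mod)
        finally show ?thesis using True by simp
      next
        case False
        then obtain u where "u \<in> units_mod q" "\<psi> i u \<noteq> 1" using nontriv \<open>i < k\<close> by blast
        then have "char_mean (\<psi> i) q = 0" using char_mean_nontrivial[OF q(1)] \<psi> that by blast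
        then show ?thesis using False by simp
      qed
      then have "(\<Sum>i<k. c i / of_nat k * (char_mean (\<psi> i) q * ?I)) = (\<Sum>i<k. of_bool (i = 0) * (?I / of_nat k))"
        by (intro sum.cong refl) (simp add: field_simps flip: mult.assoc)
      also have "\<dots> = (\<Sum>i\<in>{0::nat}. of_bool (i = 0) * (?I / of_nat k))"
        using k by (intro sum.mono_neutral_right) auto
      finally show ?thesis by simp
    qed
    ultimately have "kl_avg f P q t - ?I / of_nat k
        = (\<Sum>i<k. c i / of_nat k * (twisted_avg f (\<psi> i) q t - char_mean (\<psi> i) q * ?I))"
      by (simp only: right_diff_distrib sum_subtractf)
    also have "norm \<dots> \<le> of_nat (card {..<k}) * (e / 2 / of_nat k)"
    proof (rule sum_norm_bound)
      fix i assume i: "i \<in> {..<k}"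
      have "norm (twisted_avg f (\<psi> i) q t - char_mean (\<psi> i) q * ?I) \<le> e / 2"
        using Q[OF q(2) _ t] \<psi> i by (simp add: less_imp_le)
      from divide_right_mono[OF this, of "real k"]
      show "norm (c i / of_nat k * (twisted_avg f (\<psi> i) q t - char_mean (\<psi> i) q * ?I)) \<le> e / 2 / of_nat k"
        using c i by (simp add: norm_mult norm_divide)
    qed
    also have "\<dots> < e" using k e by simp
    finally show "norm (kl_avg f P q t - ?I / of_nat k) < e" .
  qed
qed

section \<open>The Jacobi symbol\<close>

lemma Legendre_cong:
  assumes "[a = b] (mod p)"
  shows "Legendre a p = Legendre b p"
proof -
  have "[a = 0] (mod p) \<longleftrightarrow> [b = 0] (mod p)" "QuadRes p a \<longleftrightarrow> QuadRes p b"
    using assms unfolding QuadRes_def by (meson cong_sym cong_trans)+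
  then show ?thesis by (simp add: Legendre_def)
qed

lemma Legendre_values: "Legendre a p \<in> {-1, 0, 1}"
  by (simp add: Legendre_def)

text \<open>For odd \<open>p\<close>, Euler's criterion gives the congruence modulo
  \<open>p\<close>, and the two sides differ by at most 2, which is less than \<open>p\<close>. For
  \<open>p = 2\<close> every odd number is a residue, so the symbol is the indicator of
  oddness.\<close>

lemma Legendre_mult:
  assumes "prime p"
  shows "Legendre (a * b) p = Legendre a p * Legendre b p"
proof (cases "p = 2")
  case True
  have "Legendre c 2 = of_bool (odd c)" for c
  proof -
    have "QuadRes 2 c" if "odd c"
      unfolding QuadRes_def using that by (intro exI[of _ 1]) (simp add: cong_iff_dvd_diff)
    then show ?thesis by (auto simp: Legendre_def cong_0_iff)
  qed
  then show ?thesis using True by auto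
next
  case False
  define r where "r = nat p"
  have "p > 2" using prime_ge_2_int[OF assms] False by simp
  moreover have "prime (nat p)" using assms prime_int_nat_transfer by blast
  ultimately have p: "p = int r" "prime r" "r > 2" by (simp_all add: r_def)
  have "[Legendre (a * b) p = (a * b) ^ ((r - 1) div 2)] (mod p)"
    using euler_criterion[OF p(2,3)] p(1) by simp
  also have "(a * b) ^ ((r - 1) div 2) = a ^ ((r - 1) div 2) * b ^ ((r - 1) div 2)"
    by (rule power_mult_distrib)
  also have "[\<dots> = Legendre a p * Legendre b p] (mod p)"
    using euler_criterion[OF p(2,3), THEN cong_sym] p(1) by (intro cong_mult) auto
  finally have dvd: "p dvd Legendre (a * b) p - Legendre a p * Legendre b p"
    by (simp add: cong_iff_dvd_diff)
  have "\<bar>Legendre (a * b) p - Legendre a p * Legendre b p\<bar> \<le> 2"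
    using Legendre_values[of "a * b" p] Legendre_values[of a p] Legendre_values[of b p] by auto
  then have "\<bar>Legendre (a * b) p - Legendre a p * Legendre b p\<bar> < p" using p by simp
  then have "Legendre (a * b) p - Legendre a p * Legendre b p = 0"
    using dvd by (metis dvd_abs_iff zdvd_not_zless zero_less_abs_iff)
  then show ?thesis by simp
qed

lemma Jacobi_altdef: "Jacobi a b = prod_mset (image_mset (Legendre a) (prime_factorization b))"
  unfolding Jacobi_def image_prod_mset_multiplicity
  by (intro prod.cong refl) (simp add: count_prime_factorization_prime in_prime_factors_imp_prime)

lemma Jacobi_mult_right:
  assumes "b \<noteq> 0" "c \<noteq> 0"
  shows "Jacobi a (b * c) = Jacobi a b * Jacobi a c"
  using assms by (simp add: Jacobi_altdef prime_factorization_mult)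

lemma Jacobi_mult_left: "Jacobi (a * a') b = Jacobi a b * Jacobi a' b"
  unfolding Jacobi_def
  by (simp add: Legendre_mult in_prime_factors_imp_prime power_mult_distrib prod.distrib)

lemma Jacobi_power_left: "Jacobi (a ^ n) b = Jacobi a b ^ n" if "Jacobi 1 b = 1"
  by (induction n) (simp_all add: Jacobi_mult_left that)

lemma Jacobi_power_right:
  assumes "b \<noteq> 0"
  shows "Jacobi a (b ^ n) = Jacobi a b ^ n"
  using assms by (induction n) (simp_all add: Jacobi_mult_right, simp add: Jacobi_def)

lemma Jacobi_cong:
  assumes "[a = a'] (mod b)"
  shows "Jacobi a b = Jacobi a' b"
  unfolding Jacobi_def
proof (intro prod.cong refl)
  fix p assume "p \<in> prime_factors b"
  then have "[a = a'] (mod p)" using assms cong_dvd_modulus by blast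
  then show "Legendre a p ^ multiplicity p b = Legendre a' p ^ multiplicity p b"
    by (simp add: Legendre_cong)
qed

lemma Jacobi_prime:
  assumes "prime p"
  shows "Jacobi a p = Legendre a p"
  using assms by (simp add: Jacobi_altdef prime_factorization_prime)

lemma Jacobi_1_left: "Jacobi 1 b = 1"
proof -
  have "Legendre 1 p = 1" if "prime p" for p
    using that prime_gt_1_int[OF that]
    by (auto simp: Legendre_def cong_0_iff QuadRes_def intro!: exI[of _ 1])
  then show ?thesis by (simp add: Jacobi_def in_prime_factors_imp_prime)
qed

lemma Jacobi_1_right: "Jacobi a 1 = 1"
  by (simp add: Jacobi_def)

lemma Jacobi_coprime:
  assumes "coprime a b"
  shows "Jacobi a b \<in> {1, -1}"
proof -
  have "\<bar>Jacobi a b\<bar> = (\<Prod>p\<in>prime_factors b. \<bar>Legendre a p\<bar> ^ multiplicity p b)"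
    by (simp add: Jacobi_def abs_prod power_abs)
  also have "\<dots> = 1"
  proof (intro prod.neutral ballI)
    fix p assume p: "p \<in> prime_factors b"
    have "\<not> p dvd a"
      using p assms by (meson coprime_common_divisor in_prime_factors_imp_dvd in_prime_factors_imp_prime not_prime_unit)
    then show "\<bar>Legendre a p\<bar> ^ multiplicity p b = 1"
      by (simp add: Legendre_def cong_0_iff)
  qed
  finally show ?thesis by auto
qed

section \<open>Quadratic reciprocity and the supplementary law for 2\<close>

lemma odd_prime_gt_2: "prime p \<Longrightarrow> odd p \<Longrightarrow> p > 2" for p :: nat
  using prime_ge_2_nat[of p] by (cases "p = 2") auto

lemma coprime_8: "odd n \<Longrightarrow> coprime 8 n" for n :: nat
  using coprime_power_left_iff[of 2 3 n] by simp

text \<open>For odd arguments this is the reciprocity sign, -1 to the power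
  \<open>(m - 1) div 2 * ((n - 1) div 2)\<close>, written so that its dependence on residues modulo
  4 is visible.\<close>

definition recip_sign :: "nat \<Rightarrow> nat \<Rightarrow> int" where
  "recip_sign m n = (if m mod 4 = 3 \<and> n mod 4 = 3 then -1 else 1)"

lemma odd_mod_4: "odd (n :: nat) \<Longrightarrow> n mod 4 = 1 \<or> n mod 4 = 3"
  by presburger

lemma mult_mod_4_eq_3_iff:
  assumes "odd m" "odd (n :: nat)"
  shows "m * n mod 4 = 3 \<longleftrightarrow> (m mod 4 = 3) \<noteq> (n mod 4 = 3)"
  using odd_mod_4[OF assms(1)] odd_mod_4[OF assms(2)] by (elim disjE) (simp_all add: mod_mult_eq[of m 4 n, symmetric])

lemma recip_sign_mult_left:
  assumes "odd m" "odd m'"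
  shows "recip_sign (m * m') n = recip_sign m n * recip_sign m' n"
  using assms by (auto simp: recip_sign_def mult_mod_4_eq_3_iff)

lemma recip_sign_commute: "recip_sign m n = recip_sign n m"
  by (auto simp: recip_sign_def)

lemma odd_nat_prime_induct [consumes 1, case_names one factor]:
  assumes "odd (n :: nat)" "P 1" "\<And>r m. prime r \<Longrightarrow> odd r \<Longrightarrow> odd m \<Longrightarrow> P m \<Longrightarrow> P (r * m)"
  shows "P n"
  using assms(1)
proof (induction n rule: less_induct)
  case (less n)
  show ?case
  proof (cases "n = 1")
    case False
    then obtain r where r: "prime r" "r dvd n" using prime_factor_nat by blast
    then obtain m where m: "n = r * m" by blast
    have "m > 0" "r > 1" using less.prems m prime_gt_1_nat[OF r(1)] by (auto intro: Nat.gr0I)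
    then have "m < n" using m by simp
    then show ?thesis using less m assms(3)[OF r(1)] by auto
  qed (use assms in simp)
qed

lemma Legendre_reciprocity:
  assumes "prime p" "odd p" "prime q" "odd q" "p \<noteq> q"
  shows "Legendre (int p) (int q) = Legendre (int q) (int p) * recip_sign p q"
proof -
  have gt: "2 < p" "2 < q" using assms by (auto intro: odd_prime_gt_2)
  have "even ((p - 1) div 2) \<longleftrightarrow> p mod 4 \<noteq> 3" "even ((q - 1) div 2) \<longleftrightarrow> q mod 4 \<noteq> 3"
    using assms by presburger+
  then have "(-1 :: int) ^ ((p - 1) div 2 * ((q - 1) div 2)) = recip_sign p q"
    by (auto simp: recip_sign_def minus_one_power_iff)
  then have eq: "Legendre (int p) (int q) * Legendre (int q) (int p) = recip_sign p q"
    using Quadratic_Reciprocity[OF assms(1) gt(1) assms(3) gt(2) assms(5)] by simp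
  have "Legendre (int q) (int p) * Legendre (int q) (int p) = 1"
    using eq Legendre_values[of "int q" "int p"] by (auto simp: recip_sign_def split: if_splits)
  then show ?thesis using eq by (metis mult.assoc mult.commute mult_1)
qed

text \<open>Both sides are multiplicative in \<open>m\<close>, so reciprocity passes from prime
  \<open>m\<close> to odd \<open>m\<close>. The prime case is a premise so that the lemma can be
  applied once for each argument of the symbol.\<close>

lemma Jacobi_reciprocity_of_primes:
  assumes "odd m" "coprime m n"
    and "\<And>r. prime r \<Longrightarrow> odd r \<Longrightarrow> coprime r n \<Longrightarrow>
      Jacobi (int r) (int n) = Jacobi (int n) (int r) * recip_sign r n"
  shows "Jacobi (int m) (int n) = Jacobi (int n) (int m) * recip_sign m n"
  using assms(1,2)
proof (induction m rule: odd_nat_prime_induct)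
  case one
  then show ?case by (simp add: Jacobi_1_left Jacobi_1_right recip_sign_def)
next
  case (factor r m)
  then have "Jacobi (int r) (int n) = Jacobi (int n) (int r) * recip_sign r n"
    "Jacobi (int m) (int n) = Jacobi (int n) (int m) * recip_sign m n"
    using assms(3) by auto
  moreover have "r > 0" "m > 0" using factor by (auto intro: Nat.gr0I)
  ultimately show ?case
    using factor by (simp add: Jacobi_mult_left Jacobi_mult_right recip_sign_mult_left)
qed

lemma Jacobi_reciprocity:
  assumes "odd m" "odd n" "coprime m n"
  shows "Jacobi (int m) (int n) = Jacobi (int n) (int m) * recip_sign m n"
proof (rule Jacobi_reciprocity_of_primes[OF assms(1,3)])
  fix r assume r: "prime r" "odd r" "coprime r n"
  \<comment> \<open>For a fixed prime \<open>r\<close> the roles are exchanged: now \<open>n\<close>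
    is factored, which leaves two primes and Legendre reciprocity.\<close>
  have "Jacobi (int n) (int r) = Jacobi (int r) (int n) * recip_sign n r"
  proof (rule Jacobi_reciprocity_of_primes[OF assms(2)])
    fix s assume s: "prime s" "odd s" "coprime s r"
    then have "s \<noteq> r" using r by (auto simp: prime_nat_iff)
    then show "Jacobi (int s) (int r) = Jacobi (int r) (int s) * recip_sign s r"
      using Legendre_reciprocity[OF s(1,2) r(1,2)] r s by (simp add: Jacobi_prime)
  qed (use r in \<open>simp add: coprime_commute\<close>)
  then show "Jacobi (int r) (int n) = Jacobi (int n) (int r) * recip_sign r n"
    by (auto simp: recip_sign_def)
qed

text \<open>Gauss's lemma for the multiplier 2: the sign counts the doubled numbers exceeding
  \<open>h = (p - 1) div 2\<close>.\<close>

lemma Legendre_two: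
  assumes "prime p" "odd p"
  shows "Legendre 2 (int p) = (if p mod 8 \<in> {1, 7} then 1 else -1)"
proof -
  have p: "p > 2" using assms by (intro odd_prime_gt_2)
  have "\<not> int p dvd 2" using p zdvd_imp_le by force
  then interpret GAUSS p 2
    by unfold_locales (use assms p in \<open>auto simp: cong_0_iff\<close>)
  define h where "h = (int p - 1) div 2"
  have h: "2 * h < int p" "h > 0" using p by (auto simp: h_def)
  \<comment> \<open>As \<open>2 * h < p\<close>, the doubled numbers are already reduced modulo
    \<open>p\<close>. Those exceeding \<open>h\<close> come from \<open>x > h div 2\<close>, and the
    parity of their number depends on \<open>p\<close> modulo 8.\<close>
  have "C = (\<lambda>x. 2 * x) ` {0<..h}"
    unfolding C_def B_def A_def image_image h_def[symmetric]
    by (intro image_cong refl) (use h in \<open>auto simp: mult.commute\<close>)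
  then have "E = (\<lambda>x. 2 * x) ` {h div 2<..h}"
    unfolding E_def h_def[symmetric] using h by (auto simp: image_iff)
  then have "card E = nat (h - h div 2)" by (simp add: card_image inj_on_def)
  then have L: "Legendre 2 (int p) = (-1) ^ nat (h - h div 2)" using gauss_lemma by simp
  have "even (nat (h - h div 2)) \<longleftrightarrow> even (h - h div 2)"
    using h by (simp add: even_nat_iff)
  also have "\<dots> \<longleftrightarrow> int p mod 8 = 1 \<or> int p mod 8 = 7"
  proof -
    have "odd (int p)" using assms by simp
    then show ?thesis unfolding h_def by presburger
  qed
  also have "\<dots> \<longleftrightarrow> p mod 8 \<in> {1, 7}" by (auto simp: zmod_int[of p 8, simplified, symmetric])
  finally show ?thesis unfolding L by (simp add: minus_one_power_iff)
qed

lemma Jacobi_two: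
  assumes "odd n"
  shows "Jacobi 2 (int n) = (if n mod 8 \<in> {1, 7} then 1 else -1)"
  using assms
proof (induction n rule: odd_nat_prime_induct)
  case one
  then show ?case by (simp add: Jacobi_1_right)
next
  case (factor r m)
  have "r > 0" "m > 0" using factor by (auto intro: Nat.gr0I)
  then have "Jacobi 2 (int (r * m)) = (if r mod 8 \<in> {1, 7} then 1 else -1) * (if m mod 8 \<in> {1, 7} then 1 else -1)"
    using factor by (simp add: Jacobi_mult_right Jacobi_prime Legendre_two)
  moreover have "r mod 8 \<in> {1, 3, 5, 7}" "m mod 8 \<in> {1, 3, 5, 7}"
    using factor.hyps by (simp_all) presburger+
  ultimately show ?case by (elim insertE emptyE) (simp_all add: mod_mult_eq[of r 8 m, symmetric])
qed

section \<open>Arguments at which the symbol takes the value -1\<close>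

lemma Legendre_nonresidue_exists:
  assumes "prime p" "odd p"
  obtains g where "Legendre (int g) (int p) = -1" "\<not> p dvd g"
proof -
  have p: "p > 2" using assms by (intro odd_prime_gt_2)
  let ?f = "\<lambda>x. x\<^sup>2 mod p"
  have sub: "?f ` {1..<p} \<subseteq> {1..<p}"
  proof (rule image_subsetI)
    fix x assume "x \<in> {1..<p}"
    then have "\<not> p dvd x" by (auto dest: dvd_imp_le)
    then have "x\<^sup>2 mod p \<noteq> 0" using assms(1) prime_dvd_power by (auto simp: mod_eq_0_iff_dvd)
    then show "?f x \<in> {1..<p}" using p by simp
  qed
  \<comment> \<open>Since 1 and \<open>p - 1\<close> have the same square, squaring is not injective
    on the nonzero residues; by finiteness it misses one, which is the desired nonresidue.\<close>
  have "\<not> inj_on ?f {1..<p}"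
  proof
    assume "inj_on ?f {1..<p}"
    moreover have "?f (p - 1) = ?f 1"
    proof -
      have "[int (p - 1) = - 1] (mod int p)" using p by (simp add: cong_iff_dvd_diff)
      then have "[int (p - 1) ^ 2 = (- 1) ^ 2] (mod int p)" by (rule cong_pow)
      then have "[int ((p - 1)\<^sup>2) = int (1\<^sup>2)] (mod int p)" by simp
      then have "[(p - 1)\<^sup>2 = 1\<^sup>2] (mod p)" by (simp only: cong_int_iff)
      then show ?thesis by (simp only: cong_def)
    qed
    moreover have "p - 1 \<in> {1..<p}" "1 \<in> {1..<p}" using p by auto
    ultimately have "p - 1 = 1" by (rule inj_onD)
    then show False using p by simp
  qed
  then have "?f ` {1..<p} \<noteq> {1..<p}" using finite_surj_inj[of "{1..<p}" ?f] by auto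
  with sub obtain g where g: "g \<in> {1..<p}" "g \<notin> ?f ` {1..<p}" by blast
  have ndvd: "\<not> p dvd g" using g(1) by (auto dest: dvd_imp_le)
  have "\<not> QuadRes (int p) (int g)"
  proof
    assume "QuadRes (int p) (int g)"
    then obtain y where y: "[y\<^sup>2 = int g] (mod int p)" by (auto simp: QuadRes_def)
    define x where "x = nat (y mod int p)"
    have x: "int x = y mod int p" "x < p" using p by (auto simp: x_def nat_less_iff)
    have "[int (x\<^sup>2) = int g] (mod int p)"
      using y by (simp add: x cong_def mod_simps)
    then have "[x\<^sup>2 = g] (mod p)" by (simp only: cong_int_iff)
    then have "x\<^sup>2 mod p = g mod p" by (simp only: cong_def)
    then have "?f x = g" using g(1) by simp
    moreover have "x \<noteq> 0" using \<open>?f x = g\<close> g(1) by (intro notI) simp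
    ultimately show False using g(2) x(2) by (metis One_nat_def Suc_leI atLeastLessThan_iff image_eqI neq0_conv)
  qed
  then have "Legendre (int g) (int p) = -1"
    using ndvd by (simp add: Legendre_def cong_0_iff)
  then show ?thesis using ndvd that by blast
qed

text \<open>A non-square has a prime \<open>r\<close> of odd multiplicity. The Chinese remainder
  theorem gives \<open>u\<close> congruent to a nonresidue modulo \<open>r\<close> and to 1 modulo
  the rest of \<open>q\<close>. The condition modulo 8 neutralises the symbol of 2 and the
  reciprocity sign when the upper argument is treated.\<close>

lemma Jacobi_nontrivial:
  assumes "odd q" "\<not> is_square q"
  obtains u where "Jacobi (int u) (int q) = -1" "[u = 1] (mod 8)" "coprime u q"
proof -
  obtain r where r: "prime r" "odd (multiplicity r q)"
    using assms(2) is_nth_power_conv_multiplicity_nat[of 2 q] by auto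
  have q0: "q > 0" using assms(1) by (auto intro: Nat.gr0I)
  define k where "k = multiplicity r q"
  obtain m where m: "q = r ^ k * m" "\<not> r dvd m"
    using multiplicity_decompose'[of q r] q0 r(1) not_prime_unit unfolding k_def by blast
  have "k > 0" using r(2) by (auto simp: k_def intro: Nat.gr0I)
  then have "odd r" "odd m" using assms(1) m(1) by auto
  obtain g where g: "Legendre (int g) (int r) = -1" "\<not> r dvd g"
    using Legendre_nonresidue_exists r(1) \<open>odd r\<close> by blast
  have "coprime r (8 * m)"
    using coprime_8[OF \<open>odd r\<close>] prime_imp_coprime[OF r(1) m(2)] by (simp add: coprime_commute)
  then obtain u where u: "[u = g] (mod r)" "[u = 1] (mod 8 * m)"
    using binary_chinese_remainder_nat[of r "8 * m" g 1] by blast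
  have u8: "[u = 1] (mod 8)" and um: "[u = 1] (mod m)"
    using u(2) cong_dvd_modulus_nat[of u 1 "8 * m"] by auto
  have "Jacobi (int u) (int q) = Jacobi (int u) (int r) ^ k * Jacobi (int u) (int m)"
    using q0 m(1) \<open>odd r\<close> by (cases "r = 0") (auto simp: Jacobi_mult_right Jacobi_power_right)
  also have "Jacobi (int u) (int m) = 1"
    using Jacobi_cong[of "int u" 1 "int m"] um cong_int_iff[of u 1 m] by (simp add: Jacobi_1_left)
  also have "Jacobi (int u) (int r) = -1"
    using Legendre_cong[of "int u" "int g" "int r"] u(1) g(1) r(1) by (simp add: Jacobi_prime cong_int_iff)
  finally have "Jacobi (int u) (int q) = -1" using r(2) by (simp add: k_def)
  moreover have "coprime u q"
  proof -
    have "\<not> r dvd u" using u(1) g(2) by (simp add: cong_dvd_iff)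
    from prime_imp_coprime[OF r(1) this] have "coprime u r" by (simp add: coprime_commute)
    moreover have "coprime u m" using um by (metis cong_imp_coprime cong_sym coprime_1_left)
    ultimately show ?thesis by (simp add: m(1))
  qed
  ultimately show ?thesis using u8 that by blast
qed

section \<open>The symbol with upper argument \<open>q\<close> divisible by 4, as a function of its
  lower argument\<close>

context
  fixes q a m :: nat
  assumes q: "q = 2 ^ a * m" and m: "odd m" and q4: "q mod 4 = 0" and q0: "q > 0"
begin

text \<open>The factor \<open>Jacobi 2 p ^ a\<close> depends on \<open>p\<close> modulo 8. It is
  either trivial because \<open>a\<close> is even, or still periodic modulo \<open>q\<close>: an odd
  \<open>a\<close> with 4 dividing \<open>q\<close> is at least 3.\<close>

lemma two_power_exponent: "even a \<or> 8 dvd q" "a > 0"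
proof -
  show "a > 0"
  proof (rule Nat.gr0I)
    assume "a = 0"
    then have "q = m" using q by simp
    then show False using m q4 by presburger
  qed
  show "even a \<or> 8 dvd q"
  proof (cases "a \<ge> 3")
    case True
    then have "2 ^ 3 dvd (2 :: nat) ^ a" by (rule le_imp_power_dvd)
    then show ?thesis by (simp add: q)
  next
    case False
    then have "a = 1 \<or> a = 2" using \<open>a > 0\<close> by auto
    moreover have "a \<noteq> 1"
    proof
      assume "a = 1"
      then have "q = 2 * m" using q by simp
      then show False using m q4 by presburger
    qed
    ultimately show ?thesis by auto
  qed
qed

text \<open>Reciprocity flips the odd part of \<open>q\<close> into the lower position, so that
  \<open>p\<close> enters only through residues modulo 8, \<open>m\<close> and 4.\<close>

lemma Jacobi_upper_even:
  assumes "coprime p q"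
  shows "Jacobi (int q) (int p) = Jacobi 2 (int p) ^ a * (Jacobi (int p) (int m) * recip_sign p m)"
proof -
  have "odd p" "coprime p m" using assms two_power_exponent(2) by (auto simp: q coprime_commute)
  then show ?thesis
    using Jacobi_reciprocity[OF m \<open>odd p\<close>] by (simp add: q Jacobi_mult_left Jacobi_power_left Jacobi_1_left
        coprime_commute recip_sign_commute)
qed

lemma Jacobi_upper_periodic:
  assumes "coprime p q" "[p = p'] (mod q)"
  shows "Jacobi (int q) (int p) = Jacobi (int q) (int p')"
proof -
  have cop: "coprime p' q" using assms cong_imp_coprime by blast
  have odd: "odd p" "odd p'" using assms(1) cop two_power_exponent(2) by (auto simp: q)
  have "[p = p'] (mod 4)" using assms(2) q4 cong_dvd_modulus_nat by (metis mod_0_imp_dvd)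
  then have "recip_sign p m = recip_sign p' m" by (simp add: recip_sign_def cong_def)
  moreover have "[p = p'] (mod m)" using assms(2) q cong_dvd_modulus_nat by (metis dvd_triv_right)
  then have "Jacobi (int p) (int m) = Jacobi (int p') (int m)" by (intro Jacobi_cong) (simp add: cong_int_iff)
  moreover have "Jacobi 2 (int p) ^ a = Jacobi 2 (int p') ^ a"
    using two_power_exponent(1)
  proof
    assume "even a"
    then show ?thesis using odd by (simp add: Jacobi_two)
  next
    assume "8 dvd q"
    then have "[p = p'] (mod 8)" using assms(2) cong_dvd_modulus_nat by blast
    then show ?thesis using odd by (simp add: Jacobi_two cong_def)
  qed
  ultimately show ?thesis using Jacobi_upper_even assms(1) cop by simp
qed

text \<open>The requirement \<open>u mod 4 = 1\<close> lets the same \<open>u\<close> witness the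
  nontriviality of the symbol and of its product with the character modulo 4. If \<open>m\<close> is
  not a square, a witness for \<open>m\<close> serves. Otherwise \<open>a\<close> is odd, and the
  value -1 comes from the symbol of 2 at \<open>u\<close> congruent to 5 modulo 8.\<close>

lemma Jacobi_upper_nontrivial:
  assumes "\<not> is_square q"
  obtains u where "coprime u q" "u mod 4 = 1" "Jacobi (int q) (int u) = -1"
proof (cases "is_square m")
  case False
  obtain u where u: "Jacobi (int u) (int m) = -1" "[u = 1] (mod 8)" "coprime u m"
    using Jacobi_nontrivial[OF m False] by blast
  have u8: "u mod 8 = 1" using u(2) by (simp add: cong_def)
  then have "odd u" "u mod 4 = 1" by presburger+
  then have cop: "coprime u q" using u(3) by (simp add: q)
  moreover have "Jacobi (int q) (int u) = -1"
    using Jacobi_upper_even[OF cop] u(1) u8 \<open>odd u\<close> \<open>u mod 4 = 1\<close>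
    by (simp add: Jacobi_two recip_sign_def)
  ultimately show ?thesis using that \<open>u mod 4 = 1\<close> by blast
next
  case True
  have "odd a"
  proof
    assume "even a"
    then obtain b where "a = b * 2" by (metis dvdE mult.commute)
    then have "is_square ((2 :: nat) ^ a)" by (simp add: power_mult)
    then show False using True assms is_nth_power_mult[of 2 "2 ^ a" m] by (simp add: q)
  qed
  from m have "coprime 8 m" by (rule coprime_8)
  then obtain u where u: "[u = 5] (mod 8)" "[u = 1] (mod m)"
    using binary_chinese_remainder_nat[of 8 m 5 1] by blast
  have u8: "u mod 8 = 5" using u(1) by (simp add: cong_def)
  then have "odd u" "u mod 4 = 1" by presburger+
  have "coprime u m" using u(2) by (metis cong_imp_coprime cong_sym coprime_1_left)
  then have cop: "coprime u q" using \<open>odd u\<close> by (simp add: q)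
  have "Jacobi (int u) (int m) = 1"
    using Jacobi_cong[of "int u" 1 "int m"] u(2) cong_int_iff[of u 1 m] by (simp add: Jacobi_1_left)
  then have "Jacobi (int q) (int u) = -1"
    using Jacobi_upper_even[OF cop] u8 \<open>odd u\<close> \<open>u mod 4 = 1\<close> \<open>odd a\<close>
    by (simp add: Jacobi_two recip_sign_def)
  then show ?thesis using that \<open>u mod 4 = 1\<close> cop by blast
qed

end

section \<open>The four convergences\<close>

lemma unit_char_trivial: "unit_char q (\<lambda>_. 1)"
  by (simp add: unit_char_def)

lemma unit_char_mult: "unit_char q \<psi> \<Longrightarrow> unit_char q \<psi>' \<Longrightarrow> unit_char q (\<lambda>p. \<psi> p * \<psi>' p)"
  by (simp add: unit_char_def norm_mult)

text \<open>On odd numbers, the only arguments relevant when 4 divides \<open>q\<close>, this is the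
  nontrivial Dirichlet character modulo 4.\<close>

definition char_mod4 :: "nat \<Rightarrow> complex" where
  "char_mod4 n = (if n mod 4 = 1 then 1 else -1)"

lemma odd_units_mod:
  assumes "q mod 4 = 0" "p \<in> units_mod q"
  shows "odd p"
proof
  assume "even p"
  moreover have "even q" using assms(1) by presburger
  ultimately show False using coprime_units_mod[OF assms(2)] by (metis coprime_common_divisor odd_one)
qed

lemma unit_char_mod4:
  assumes "q mod 4 = 0"
  shows "unit_char q char_mod4"
proof -
  have "char_mod4 (p * u mod q) = char_mod4 p * char_mod4 u" if "p \<in> units_mod q" "u \<in> units_mod q" for p u
  proof -
    have "odd p" "odd u" using that odd_units_mod[OF assms] by auto
    moreover from this have "odd (p * u)" by simp
    ultimately have "p mod 4 \<noteq> 1 \<longleftrightarrow> p mod 4 = 3" "u mod 4 \<noteq> 1 \<longleftrightarrow> u mod 4 = 3" "p * u mod 4 \<noteq> 1 \<longleftrightarrow> p * u mod 4 = 3"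
      using odd_mod_4[of p] odd_mod_4[of u] odd_mod_4[of "p * u"] by auto
    moreover have "p * u mod q mod 4 = p * u mod 4" using assms by (auto intro: mod_mod_cancel)
    ultimately show ?thesis
      using mult_mod_4_eq_3_iff[OF \<open>odd p\<close> \<open>odd u\<close>] by (auto simp: char_mod4_def)
  qed
  then show ?thesis by (simp add: unit_char_def char_mod4_def)
qed

lemma unit_char_mod4_nontrivial:
  assumes "q mod 4 = 0" "q > 0"
  shows "\<exists>u\<in>units_mod q. char_mod4 u \<noteq> 1"
proof
  have "q \<ge> 4" using assms by presburger
  then show "q - 1 \<in> units_mod q"
    using coprime_diff_one_left_nat[of q] by (simp add: units_mod_def)
  have "(q - 1) mod 4 = 3"
  proof -
    obtain k where "q = 4 * k" using assms(1) by auto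
    moreover from this obtain j where "k = Suc j" using assms(2) by (cases k) auto
    ultimately have "q - 1 = 4 * j + 3" by simp
    then show ?thesis by simp
  qed
  then show "char_mod4 (q - 1) \<noteq> 1" by (simp add: char_mod4_def)
qed

lemma norm_of_int_Jacobi: "coprime a b \<Longrightarrow> norm (of_int (Jacobi a b) :: complex) = 1"
  using Jacobi_coprime[of a b] by auto

lemma coprime_int_units_mod:
  assumes "p \<in> units_mod q"
  shows "coprime (int p) (int q)" "coprime (int q) (int p)"
  using coprime_units_mod[OF assms] coprime_commute[of q p] by simp_all

lemma unit_char_Jacobi: "unit_char q (\<lambda>p. of_int (Jacobi (int p) (int q)))"
proof -
  have "Jacobi (int (p * u mod q)) (int q) = Jacobi (int p) (int q) * Jacobi (int u) (int q)" for p u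
    using Jacobi_cong[of "int (p * u mod q)" "int p * int u" "int q"]
    by (simp add: cong_def zmod_int Jacobi_mult_left)
  then show ?thesis
    unfolding unit_char_def
    by (intro conjI ballI norm_of_int_Jacobi coprime_int_units_mod) simp_all
qed

lemma unit_char_Jacobi_nontrivial:
  assumes "odd q" "\<not> (\<exists>m. q = m ^ 2)" "q \<ge> 2"
  shows "\<exists>u\<in>units_mod q. (of_int (Jacobi (int u) (int q)) :: complex) \<noteq> 1"
proof -
  obtain u where u: "Jacobi (int u) (int q) = -1" "coprime u q"
    using Jacobi_nontrivial[of q] assms by (auto simp: is_nth_power_def)
  have "Jacobi (int (u mod q)) (int q) = -1"
    using Jacobi_cong[of "int (u mod q)" "int u" "int q"] u(1) by (simp add: cong_def zmod_int)
  then show ?thesis using mod_in_units_mod[OF assms(3) u(2)] by (intro bexI[of _ "u mod q"]) auto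
qed

lemma two_power_decomposition:
  fixes q :: nat
  assumes "q > 0"
  obtains a m where "q = 2 ^ a * m" "odd m"
proof -
  have "q \<noteq> 0" "\<not> is_unit (2 :: nat)" using assms by simp_all
  from multiplicity_decompose'[OF this] show thesis using that by blast
qed

text \<open>The symbol is multiplicative in its lower argument; periodicity permits reducing the
  product modulo \<open>q\<close>.\<close>

lemma unit_char_Jacobi_upper:
  assumes "q mod 4 = 0" "q \<ge> 2"
  shows "unit_char q (\<lambda>p. of_int (Jacobi (int q) (int p)))"
proof -
  have q0: "q > 0" using assms by simp
  obtain a m where am: "q = 2 ^ a * m" "odd m" by (rule two_power_decomposition[OF q0])
  have "Jacobi (int q) (int (p * u mod q)) = Jacobi (int q) (int p) * Jacobi (int q) (int u)"
    if "p \<in> units_mod q" "u \<in> units_mod q" for p u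
  proof -
    have "Jacobi (int q) (int (p * u)) = Jacobi (int q) (int (p * u mod q))"
      using that coprime_units_mod
      by (intro Jacobi_upper_periodic[OF am assms(1) q0]) (auto simp: cong_def)
    moreover have "p > 0" "u > 0" using that by (auto simp: units_mod_def)
    ultimately show ?thesis by (simp add: Jacobi_mult_right)
  qed
  then show ?thesis
    unfolding unit_char_def
    by (intro conjI ballI norm_of_int_Jacobi coprime_int_units_mod) simp_all
qed

lemma unit_char_Jacobi_upper_nontrivial:
  assumes "q mod 4 = 0" "\<not> (\<exists>m. q = m ^ 2)" "q \<ge> 2"
  obtains u where "u \<in> units_mod q" "char_mod4 u = 1" "Jacobi (int q) (int u) = -1"
proof -
  have q0: "q > 0" using assms by simp
  obtain a m where am: "q = 2 ^ a * m" "odd m" by (rule two_power_decomposition[OF q0])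
  obtain u where u: "coprime u q" "u mod 4 = 1" "Jacobi (int q) (int u) = -1"
    using Jacobi_upper_nontrivial[OF am assms(1) q0] assms(2) by (auto simp: is_nth_power_def)
  have "Jacobi (int q) (int u) = Jacobi (int q) (int (u mod q))"
    by (rule Jacobi_upper_periodic[OF am assms(1) q0 u(1)]) (simp add: cong_def)
  moreover have "u mod q mod 4 = u mod 4" using assms(1) by (auto intro: mod_mod_cancel)
  ultimately show ?thesis
    using that[of "u mod q"] mod_in_units_mod[OF assms(3) u(1)] u(2,3) by (simp add: char_mod4_def)
qed

lemma of_bool_cong_mod_4:
  assumes "odd p" "\<sigma> \<in> {1, -1}"
  shows "(of_bool [int p = \<sigma>] (mod 4) :: complex) = (1 + of_int \<sigma> * char_mod4 p) / 2"
proof -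
  have "int p mod 4 = int (p mod 4)" by (simp add: zmod_int)
  then show ?thesis
    using odd_mod_4[OF assms(1)] assms(2) by (auto simp: cong_def char_mod4_def)
qed

text \<open>The condition fixes two signs: \<open>\<sigma>\<close> is real exactly when
  \<open>p\<close> is 1 modulo 4, and then \<open>J\<close> is determined. The right side expands
  \<open>(1 + s * char_mod4 p) * (1 + s' * J) / 4\<close>, the indicator of that pair of
  signs.\<close>

lemma of_bool_eps4_Jacobi:
  fixes \<sigma> :: complex
  assumes "odd p" "J \<in> {1, -1 :: int}" "\<sigma> \<in> {1, -1, \<i>, -\<i>}"
  defines "s \<equiv> (if \<sigma> \<in> {1, -1} then 1 else -1 :: complex)"
    and "s' \<equiv> (if \<sigma> \<in> {1, \<i>} then 1 else -1 :: complex)"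
  shows "(of_bool (eps4 (int p) * of_int J = \<sigma>) :: complex)
    = (1 + s * char_mod4 p + s' * of_int J + s * s' * (char_mod4 p * of_int J)) / 4"
proof -
  have "int p mod 4 = int (p mod 4)" by (simp add: zmod_int)
  then have eps: "eps4 (int p) = (if p mod 4 = 1 then 1 else \<i>)"
    using odd_mod_4[OF assms(1)] by (auto simp: eps4_def)
  have neq: "\<i> \<noteq> 1" "\<i> \<noteq> -1" "1 \<noteq> \<i>" "-1 \<noteq> \<i>" "-\<i> \<noteq> 1" "-\<i> \<noteq> -1" "1 \<noteq> -\<i>" "-1 \<noteq> -\<i>" "\<i> \<noteq> -\<i>" "-\<i> \<noteq> \<i>"
    by (simp_all add: complex_eq_iff)
  from assms(2,3) show ?thesis
    unfolding s_def s'_def char_mod4_def eps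
    by (elim insertE emptyE; cases "p mod 4 = 1") (simp_all add: neq)
qed

section \<open>Assembly of the four limits\<close>

lemma kl_avg_tendsto_real_char:
  assumes f: "torus_continuous f" and e: "e > 0" and \<sigma>: "\<sigma> \<in> {1, -1 :: int}"
  obtains Q where "\<And>q P \<psi> t. q \<ge> Q \<Longrightarrow> unit_char q \<psi> \<Longrightarrow> \<exists>u\<in>units_mod q. \<psi> u \<noteq> 1 \<Longrightarrow>
    (\<And>p. p \<in> units_mod q \<Longrightarrow> of_bool (P p) = (1 + of_int \<sigma> * \<psi> p) / 2) \<Longrightarrow> t \<in> units_mod q \<Longrightarrow>
    norm (kl_avg f P q t - integral (cbox (0, 0) (1, 1)) f / 2) < e"
proof (rule kl_avg_tendsto_char_combination[OF f e])
  fix Q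
  assume Q: "\<And>q P c \<psi> k t. q \<ge> Q \<Longrightarrow> k > 0 \<Longrightarrow>
    (\<And>i. i < k \<Longrightarrow> unit_char q (\<psi> i)) \<Longrightarrow> (\<And>i. i < k \<Longrightarrow> norm (c i) = 1) \<Longrightarrow>
    (\<And>p. p \<in> units_mod q \<Longrightarrow> c 0 * \<psi> 0 p = 1) \<Longrightarrow>
    (\<And>i. 0 < i \<Longrightarrow> i < k \<Longrightarrow> \<exists>u\<in>units_mod q. \<psi> i u \<noteq> 1) \<Longrightarrow>
    (\<And>p. p \<in> units_mod q \<Longrightarrow> of_bool (P p) = (\<Sum>i<k. c i * \<psi> i p) / of_nat k) \<Longrightarrow>
    t \<in> units_mod q \<Longrightarrow>
    norm (kl_avg f P q t - integral (cbox (0, 0) (1, 1)) f / of_nat k) < e"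
  show thesis
  proof (rule that[of Q])
    fix q P \<psi> t
    assume *: "Q \<le> q" "unit_char q \<psi>" "\<exists>u\<in>units_mod q. \<psi> u \<noteq> 1"
      "\<And>p. p \<in> units_mod q \<Longrightarrow> of_bool (P p) = (1 + of_int \<sigma> * \<psi> p) / 2" "t \<in> units_mod q"
    have "norm (kl_avg f P q t - integral (cbox (0, 0) (1, 1)) f / of_nat 2) < e"
    proof (rule Q[of q 2 "\<lambda>i. if i = 0 then (\<lambda>_. 1) else \<psi>" "\<lambda>i. if i = 0 then 1 else of_int \<sigma>"])
      fix p assume "p \<in> units_mod q"
      then show "of_bool (P p)
          = (\<Sum>i<(2::nat). (if i = 0 then 1 else of_int \<sigma>) * (if i = 0 then (\<lambda>_. 1) else \<psi>) p) / of_nat 2"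
        using *(4) by (simp add: numeral_2_eq_2)
    qed (use *(1-3,5) \<sigma> unit_char_trivial in auto)
    then show "norm (kl_avg f P q t - integral (cbox (0, 0) (1, 1)) f / 2) < e" by simp
  qed
qed

lemma kl_avg_tendsto_all:
  assumes f: "torus_continuous f" and e: "e > 0"
  shows "\<exists>Q. \<forall>q\<ge>Q. \<forall>t\<in>units_mod q.
    norm (kl_avg f (\<lambda>p. True) q t - integral (cbox (0, 0) (1, 1)) f) < e"
proof (rule kl_avg_tendsto_char_combination[OF f e])
  fix Q
  assume Q: "\<And>q P c \<psi> k t. q \<ge> Q \<Longrightarrow> k > 0 \<Longrightarrow>
    (\<And>i. i < k \<Longrightarrow> unit_char q (\<psi> i)) \<Longrightarrow> (\<And>i. i < k \<Longrightarrow> norm (c i) = 1) \<Longrightarrow>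
    (\<And>p. p \<in> units_mod q \<Longrightarrow> c 0 * \<psi> 0 p = 1) \<Longrightarrow>
    (\<And>i. 0 < i \<Longrightarrow> i < k \<Longrightarrow> \<exists>u\<in>units_mod q. \<psi> i u \<noteq> 1) \<Longrightarrow>
    (\<And>p. p \<in> units_mod q \<Longrightarrow> of_bool (P p) = (\<Sum>i<k. c i * \<psi> i p) / of_nat k) \<Longrightarrow>
    t \<in> units_mod q \<Longrightarrow>
    norm (kl_avg f P q t - integral (cbox (0, 0) (1, 1)) f / of_nat k) < e"
  show ?thesis
  proof (intro exI[of _ Q] allI impI ballI)
    fix q t assume "Q \<le> q" "t \<in> units_mod q"
    then show "norm (kl_avg f (\<lambda>p. True) q t - integral (cbox (0, 0) (1, 1)) f) < e"
      using Q[of q 1 "\<lambda>_ _. 1" "\<lambda>_. 1" "\<lambda>p. True" t] by (simp add: unit_char_trivial)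
  qed
qed

lemma kl_avg_tendsto_eps4_Jacobi:
  assumes f: "torus_continuous f" and e: "e > 0" and \<sigma>: "\<sigma> \<in> {1, -1, \<i>, -\<i>}"
  shows "\<exists>Q. \<forall>q\<ge>Q. q mod 4 = 0 \<longrightarrow> \<not> (\<exists>m. q = m ^ 2) \<longrightarrow> (\<forall>t\<in>units_mod q.
    norm (kl_avg f (\<lambda>p. eps4 (int p) * of_int (Jacobi (int q) (int p)) = \<sigma>) q t
      - integral (cbox (0, 0) (1, 1)) f / 4) < e)"
proof (rule kl_avg_tendsto_char_combination[OF f e])
  fix Q
  assume Q: "\<And>q P c \<psi> k t. q \<ge> Q \<Longrightarrow> k > 0 \<Longrightarrow>
    (\<And>i. i < k \<Longrightarrow> unit_char q (\<psi> i)) \<Longrightarrow> (\<And>i. i < k \<Longrightarrow> norm (c i) = 1) \<Longrightarrow>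
    (\<And>p. p \<in> units_mod q \<Longrightarrow> c 0 * \<psi> 0 p = 1) \<Longrightarrow>
    (\<And>i. 0 < i \<Longrightarrow> i < k \<Longrightarrow> \<exists>u\<in>units_mod q. \<psi> i u \<noteq> 1) \<Longrightarrow>
    (\<And>p. p \<in> units_mod q \<Longrightarrow> of_bool (P p) = (\<Sum>i<k. c i * \<psi> i p) / of_nat k) \<Longrightarrow>
    t \<in> units_mod q \<Longrightarrow>
    norm (kl_avg f P q t - integral (cbox (0, 0) (1, 1)) f / of_nat k) < e"
  define s where "s = (if \<sigma> \<in> {1, -1} then 1 else -1 :: complex)"
  define s' where "s' = (if \<sigma> \<in> {1, \<i>} then 1 else -1 :: complex)"
  have s: "norm s = 1" "norm s' = 1" by (auto simp: s_def s'_def)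
  show ?thesis
  proof (intro exI[of _ "max 2 Q"] allI impI ballI)
    fix q t assume "max 2 Q \<le> q" and q4: "q mod 4 = 0" and nsq: "\<not> (\<exists>m. q = m ^ 2)"
      and t: "t \<in> units_mod q"
    then have q: "q \<ge> 2" "q \<ge> Q" by auto
    define J where "J p = (of_int (Jacobi (int q) (int p)) :: complex)" for p
    define \<psi> where "\<psi> = (\<lambda>i::nat. if i = 0 then (\<lambda>_. 1) else if i = 1 then char_mod4
      else if i = 2 then J else (\<lambda>p. char_mod4 p * J p))"
    define c where "c = (\<lambda>i::nat. if i = 0 then 1 else if i = 1 then s else if i = 2 then s' else s * s')"
    have charJ: "unit_char q J" unfolding J_def using q q4 by (intro unit_char_Jacobi_upper)
    obtain u where u: "u \<in> units_mod q" "char_mod4 u = 1" "Jacobi (int q) (int u) = -1"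
      by (rule unit_char_Jacobi_upper_nontrivial[OF q4 nsq q(1)])
    have "norm (kl_avg f (\<lambda>p. eps4 (int p) * of_int (Jacobi (int q) (int p)) = \<sigma>) q t
        - integral (cbox (0, 0) (1, 1)) f / of_nat 4) < e"
    proof (rule Q[of q 4 \<psi> c])
      show "unit_char q (\<psi> i)" for i
        using charJ unit_char_mod4[OF q4] by (simp add: \<psi>_def unit_char_trivial unit_char_mult)
      show "norm (c i) = 1" for i
        using s by (simp add: c_def norm_mult)
      show "\<exists>u\<in>units_mod q. \<psi> i u \<noteq> 1" if "0 < i" for i
      proof (cases "i = 1")
        case True
        then show ?thesis using unit_char_mod4_nontrivial[OF q4] q by (simp add: \<psi>_def)
      next
        case False
        \<comment> \<open>Both remaining characters take the value -1 at \<open>u\<close>, because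
          \<open>char_mod4 u = 1\<close>.\<close>
        then have "\<psi> i u = -1" using that u by (simp add: \<psi>_def J_def)
        then show ?thesis using u(1) by (intro bexI[of _ u]) simp_all
      qed
      fix p assume p: "p \<in> units_mod q"
      have "(of_bool (eps4 (int p) * of_int (Jacobi (int q) (int p)) = \<sigma>) :: complex)
          = (1 + s * char_mod4 p + s' * J p + s * s' * (char_mod4 p * J p)) / 4"
        unfolding s_def s'_def J_def
        by (rule of_bool_eps4_Jacobi[OF odd_units_mod[OF q4 p] _ \<sigma>])
           (intro Jacobi_coprime coprime_int_units_mod p)
      also have "\<dots> = (\<Sum>i<4. c i * \<psi> i p) / of_nat 4"
        by (simp add: c_def \<psi>_def eval_nat_numeral)
      finally show "of_bool (eps4 (int p) * of_int (Jacobi (int q) (int p)) = \<sigma>)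
          = (\<Sum>i<4. c i * \<psi> i p) / of_nat 4" .
    qed (use q t in \<open>auto simp: \<psi>_def c_def\<close>)
    then show "norm (kl_avg f (\<lambda>p. eps4 (int p) * of_int (Jacobi (int q) (int p)) = \<sigma>) q t
        - integral (cbox (0, 0) (1, 1)) f / 4) < e"
      by simp
  qed
qed

lemma kl_avg_tendsto_mod4:
  assumes f: "torus_continuous f" and e: "e > 0" and \<sigma>: "\<sigma> \<in> {1, -1 :: int}"
  shows "\<exists>Q. \<forall>q\<ge>Q. q mod 4 = 0 \<longrightarrow> (\<forall>t\<in>units_mod q.
    norm (kl_avg f (\<lambda>p. [int p = \<sigma>] (mod 4)) q t - integral (cbox (0, 0) (1, 1)) f / 2) < e)"
proof (rule kl_avg_tendsto_real_char[OF f e \<sigma>])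
  fix Q
  assume Q: "\<And>q P \<psi> t. q \<ge> Q \<Longrightarrow> unit_char q \<psi> \<Longrightarrow> \<exists>u\<in>units_mod q. \<psi> u \<noteq> 1 \<Longrightarrow>
    (\<And>p. p \<in> units_mod q \<Longrightarrow> of_bool (P p) = (1 + of_int \<sigma> * \<psi> p) / 2) \<Longrightarrow> t \<in> units_mod q \<Longrightarrow>
    norm (kl_avg f P q t - integral (cbox (0, 0) (1, 1)) f / 2) < e"
  show ?thesis
  \<comment> \<open>The maximum with 1 excludes \<open>q = 0\<close>, which also satisfies
    \<open>q mod 4 = 0\<close>.\<close>
  proof (intro exI[of _ "max 1 Q"] allI impI ballI)
    fix q t assume q: "max 1 Q \<le> q" "q mod 4 = 0" and t: "t \<in> units_mod q"
    show "norm (kl_avg f (\<lambda>p. [int p = \<sigma>] (mod 4)) q t - integral (cbox (0, 0) (1, 1)) f / 2) < e"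
      by (rule Q[OF _ unit_char_mod4[OF q(2)] unit_char_mod4_nontrivial[OF q(2)]
            of_bool_cong_mod_4[OF odd_units_mod[OF q(2)] \<sigma>] t])
         (use q in auto)
  qed
qed

lemma kl_avg_tendsto_Jacobi:
  assumes f: "torus_continuous f" and e: "e > 0" and \<sigma>: "\<sigma> \<in> {1, -1 :: int}"
  shows "\<exists>Q. \<forall>q\<ge>Q. odd q \<longrightarrow> \<not> (\<exists>m. q = m ^ 2) \<longrightarrow> (\<forall>t\<in>units_mod q.
    norm (kl_avg f (\<lambda>p. Jacobi (int p) (int q) = \<sigma>) q t - integral (cbox (0, 0) (1, 1)) f / 2) < e)"
proof (rule kl_avg_tendsto_real_char[OF f e \<sigma>])
  fix Q
  assume Q: "\<And>q P \<psi> t. q \<ge> Q \<Longrightarrow> unit_char q \<psi> \<Longrightarrow> \<exists>u\<in>units_mod q. \<psi> u \<noteq> 1 \<Longrightarrow>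
    (\<And>p. p \<in> units_mod q \<Longrightarrow> of_bool (P p) = (1 + of_int \<sigma> * \<psi> p) / 2) \<Longrightarrow> t \<in> units_mod q \<Longrightarrow>
    norm (kl_avg f P q t - integral (cbox (0, 0) (1, 1)) f / 2) < e"
  show ?thesis
  proof (intro exI[of _ "max 2 Q"] allI impI ballI)
    fix q t assume q: "max 2 Q \<le> q" "odd q" "\<not> (\<exists>m. q = m ^ 2)" and t: "t \<in> units_mod q"
    show "norm (kl_avg f (\<lambda>p. Jacobi (int p) (int q) = \<sigma>) q t - integral (cbox (0, 0) (1, 1)) f / 2) < e"
    proof (rule Q[OF _ unit_char_Jacobi unit_char_Jacobi_nontrivial[OF q(2,3)] _ t])
      fix p assume "p \<in> units_mod q"
      then have "Jacobi (int p) (int q) \<in> {1, -1}" by (intro Jacobi_coprime coprime_int_units_mod)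
      then show "of_bool (Jacobi (int p) (int q) = \<sigma>)
          = (1 + of_int \<sigma> * (of_int (Jacobi (int p) (int q)) :: complex)) / 2"
        using \<sigma> by auto
    qed (use q in auto)
  qed
qed

theorem theorem3p1:
  fixes f :: "real \<times> real \<Rightarrow> complex"
  assumes "torus_continuous f"
  defines "I \<equiv> integral (cbox (0, 0) (1, 1)) f"
  shows
    "(\<forall>e>0. \<exists>Q. \<forall>q\<ge>Q. \<forall>t\<in>units_mod q.
        norm (kl_avg f (\<lambda>p. True) q t - I) < e) \<and>
    (\<forall>\<sigma>\<in>{1, -1, \<i>, -\<i>}. \<forall>e>0. \<exists>Q. \<forall>q\<ge>Q.
        q mod 4 = 0 \<longrightarrow> \<not> (\<exists>m. q = m ^ 2) \<longrightarrow> (\<forall>t\<in>units_mod q.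
        norm (kl_avg f (\<lambda>p. eps4 (int p) * of_int (Jacobi (int q) (int p)) = \<sigma>) q t
              - I / 4) < e)) \<and>
    (\<forall>\<sigma>\<in>{1, -1::int}. \<forall>e>0. \<exists>Q. \<forall>q\<ge>Q.
        q mod 4 = 0 \<longrightarrow> (\<forall>t\<in>units_mod q.
        norm (kl_avg f (\<lambda>p. [int p = \<sigma>] (mod 4)) q t - I / 2) < e)) \<and>
    (\<forall>\<sigma>\<in>{1, -1::int}. \<forall>e>0. \<exists>Q. \<forall>q\<ge>Q.
        odd q \<longrightarrow> \<not> (\<exists>m. q = m ^ 2) \<longrightarrow> (\<forall>t\<in>units_mod q.
        norm (kl_avg f (\<lambda>p. Jacobi (int p) (int q) = \<sigma>) q t - I / 2) < e))"
  unfolding I_def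
  by (intro conjI allI ballI impI kl_avg_tendsto_all kl_avg_tendsto_eps4_Jacobi
      kl_avg_tendsto_mod4 kl_avg_tendsto_Jacobi assms(1))

end
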